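(* Let $(M,\mathcal{A}_M)$ be a $\mathbb{Z}_2^n$-supermanifold, let $m\in M$, and let $f\in\mathcal{A}_M(U)$ be a $\mathbb{Z}_2^n$-function defined in a neighborhood $U$ of $m$. Let $(x,\xi)$ be (pullbacks of) coordinates centered at $m$. For any fixed degree of approximation $k\in\mathbb{N}\setminus\{0\}$, there exists a polynomial $P=P(x,\xi)$ (depending on $m$, $f$ and $k$) such that $$[f]_m-[P]_m\in\mathfrak{m}_m^{k}.$$
   Context: Fix $n\in\mathbb{N}$. $\mathbb{Z}_2=\{0,1\}$, and $\langle i,j\rangle=\sum_k i_kj_k$ for $i,j\in\mathbb{Z}_2^n$. A $\mathbb{Z}_2^n$-commutative associative unital $\mathbb{R}$-algebra is a $\mathbb{Z}_2^n$-graded associative unital $\mathbb{R}$-algebra $A=\bigoplus_{i\in\mathbb{Z}_2^n}A^i$ with $ab=(-1)^{\langle i,j\rangle}ba$ for $a\in A^i$, $b\in A^j$. Superdomains. Let $p,q\in\mathbb{N}$ and let $\xi^1,\dots,\xi^q$ be formal variables with degrees in $\mathbb{Z}_2^n\setminus\{0\}$; $\mathbf{q}=(q_1,\dots,q_{2^n-1})$, where $q_k$ is the number of these whose degree is the $k$-th element of $\mathbb{Z}_2^n\setminus\{0\}$ in lexicographic order. For $U\subset\mathbb{R}^p$ open, $C^\infty_U[[\xi^1,\dots,\xi^q]]$ denotes the sheaf $V\mapsto C^\infty(V)[[\xi^1,\dots,\xi^q]]$ of formal power series $\sum_\mu f_\mu(x)\xi^\mu$ with $f_\mu\in C^\infty(V)$,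 where functions of $x$ have degree $0$ and are central, and $\xi^a\xi^b=(-1)^{\langle\deg\xi^a,\deg\xi^b\rangle}\xi^b\xi^a$ (variables with odd $\langle\deg\xi^a,\deg\xi^a\rangle$ thus occur with exponent at most 1). The pair $(U,C^\infty_U[[\xi^1,\dots,\xi^q]])$ is a $\mathbb{Z}_2^n$-superdomain of dimension $p|\mathbf{q}$. Supermanifolds. A locally $\mathbb{Z}_2^n$-ringed space is a pair $(M,\mathcal{A}_M)$ of a Hausdorff second-countable topological space $M$ and a sheaf $\mathcal{A}_M$ of $\mathbb{Z}_2^n$-commutative associative unital $\mathbb{R}$-algebras whose stalks $\mathcal{A}_m$ are local, i.e. have a unique maximal homogeneous ideal $\mathfrak{m}_m$. A $\mathbb{Z}_2^n$-supermanifold of dimension $p|\mathbf{q}$ is a locally $\mathbb{Z}_2^n$-ringed space locally isomorphic (as locally $\mathbb{Z}_2^n$-ringed space) to a $\mathbb{Z}_2^n$-superdomain of dimension $p|\mathbf{q}$. Such a local isomorphism near $m$, sending $m$ to $x=0$ (over a convex open subset of $\mathbb{R}^p$), gives coordinates $(x,\xi)$ centered at $m$; via it, functions near $m$ are written as series $f(x,\xi)=\sum_\mu f_\mu(x)\xi^\mu$. A "polynomial" $P(x,\xi)$ here means a formal series $\sum_{|\mu|\ge0}P_\mu(x)\xi^\mu$ in the formal variables $\xi^a$ whose coefficients $P_\mu(x)$ are polynomials in the base variables $x^i$. $[f]_m\in\mathcal{A}_m$ is the germ of $f$ at $m$, and $\mathfrak{m}_m^k$ is the $k$-th power of the ideal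 $\mathfrak{m}_m$. *)

theory Defs
  imports
    "HOL-Analysis.Analysis"
    "HOL-Algebra.Ideal_Product"
    "HOL-Algebra.RingHom"
    "HOL-Algebra.Module"
    "HOL-Library.Z2"
begin

section \<open>Graded algebras\<close>

text \<open>An element of $Z_2^n$ is a function from the naturals to the two-element field that
  vanishes from index \<open>n\<close> on; this keeps \<open>n\<close> an ordinary variable and allows \<open>n = 0\<close>.\<close>

type_synonym degree = "nat \<Rightarrow> bit"

definition Z2n :: "nat \<Rightarrow> degree set" where
  "Z2n n = {i. \<forall>k\<ge>n. i k = 0}"

definition deg_zero :: degree where
  "deg_zero = (\<lambda>k. 0)"

definition deg_add :: "degree \<Rightarrow> degree \<Rightarrow> degree" where
  "deg_add i j = (\<lambda>k. i k + j k)"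

text \<open>The scalar product is taken modulo 2, which is all the sign rule depends on.\<close>

definition deg_dot :: "nat \<Rightarrow> degree \<Rightarrow> degree \<Rightarrow> bit" where
  "deg_dot n i j = (\<Sum>k<n. i k * j k)"

definition deg_sign :: "nat \<Rightarrow> degree \<Rightarrow> degree \<Rightarrow> real" where
  "deg_sign n i j = (if deg_dot n i j = 0 then 1 else - 1)"

text \<open>The \<open>k\<close>-th element of $Z_2^n$ in lexicographic order, the zero element having index 0:
  its components are the binary digits of \<open>k\<close>, most significant digit first.\<close>

definition lex_degree :: "nat \<Rightarrow> nat \<Rightarrow> degree" where
  "lex_degree n k = (\<lambda>j. if j < n \<and> odd (k div 2 ^ (n - 1 - j)) then 1 else 0)"

definition real_ring :: "real ring" where
  "real_ring = \<lparr>carrier = UNIV, mult = (*), one = 1, zero = 0, add = (+)\<rparr>"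

text \<open>The values of \<open>homog A\<close> outside \<^term>\<open>Z2n n\<close> are never used.\<close>

record 'a graded_algebra = "(real, 'a) module" +
  homog :: "degree \<Rightarrow> 'a set"

definition Z2n_comm_algebra :: "nat \<Rightarrow> 'a graded_algebra \<Rightarrow> bool" where
  "Z2n_comm_algebra n A \<longleftrightarrow>
     ring A \<and> module real_ring A \<and>
     (\<forall>c. \<forall>a\<in>carrier A. \<forall>b\<in>carrier A.
        (c \<odot>\<^bsub>A\<^esub> a) \<otimes>\<^bsub>A\<^esub> b = c \<odot>\<^bsub>A\<^esub> (a \<otimes>\<^bsub>A\<^esub> b) \<and>
        a \<otimes>\<^bsub>A\<^esub> (c \<odot>\<^bsub>A\<^esub> b) = c \<odot>\<^bsub>A\<^esub> (a \<otimes>\<^bsub>A\<^esub> b)) \<and>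
     (\<forall>i\<in>Z2n n. submodule (homog A i) real_ring A) \<and>
     (\<forall>a\<in>carrier A. \<exists>!c. c \<in> (\<Pi>\<^sub>E i\<in>Z2n n. homog A i) \<and> a = (\<Oplus>\<^bsub>A\<^esub>i\<in>Z2n n. c i)) \<and>
     (\<forall>i\<in>Z2n n. \<forall>j\<in>Z2n n. \<forall>a\<in>homog A i. \<forall>b\<in>homog A j.
        a \<otimes>\<^bsub>A\<^esub> b \<in> homog A (deg_add i j) \<and>
        a \<otimes>\<^bsub>A\<^esub> b = deg_sign n i j \<odot>\<^bsub>A\<^esub> (b \<otimes>\<^bsub>A\<^esub> a))"

definition graded_algebra_hom ::
    "nat \<Rightarrow> 'a graded_algebra \<Rightarrow> 'b graded_algebra \<Rightarrow> ('a \<Rightarrow> 'b) set" where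
  "graded_algebra_hom n A B =
     {h \<in> ring_hom A B.
        (\<forall>c. \<forall>a\<in>carrier A. h (c \<odot>\<^bsub>A\<^esub> a) = c \<odot>\<^bsub>B\<^esub> h a) \<and>
        (\<forall>i\<in>Z2n n. h ` homog A i \<subseteq> homog B i)}"

definition homogeneous_ideal :: "nat \<Rightarrow> 'a graded_algebra \<Rightarrow> 'a set \<Rightarrow> bool" where
  "homogeneous_ideal n A I \<longleftrightarrow>
     ideal I A \<and>
     (\<forall>a\<in>I. \<exists>c. (\<forall>i\<in>Z2n n. c i \<in> homog A i \<inter> I) \<and> a = (\<Oplus>\<^bsub>A\<^esub>i\<in>Z2n n. c i))"

definition maximal_homogeneous_ideal :: "nat \<Rightarrow> 'a graded_algebra \<Rightarrow> 'a set \<Rightarrow> bool" where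
  "maximal_homogeneous_ideal n A I \<longleftrightarrow>
     homogeneous_ideal n A I \<and> I \<noteq> carrier A \<and>
     (\<forall>J. homogeneous_ideal n A J \<and> I \<subseteq> J \<and> J \<noteq> carrier A \<longrightarrow> J = I)"

definition local_graded_algebra :: "nat \<Rightarrow> 'a graded_algebra \<Rightarrow> bool" where
  "local_graded_algebra n A \<longleftrightarrow> (\<exists>!I. maximal_homogeneous_ideal n A I)"


section \<open>Ringed spaces\<close>

text \<open>Only the values of \<open>sections\<close> and \<open>restr\<close> on open sets (and nested pairs of
  open sets) are used.\<close>

record ('m, 'a) graded_space =
  base :: "'m topology"
  sections :: "'m set \<Rightarrow> 'a graded_algebra"
  restr :: "'m set \<Rightarrow> 'm set \<Rightarrow> 'a \<Rightarrow> 'a"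

definition algebra_presheaf :: "nat \<Rightarrow> ('m, 'a) graded_space \<Rightarrow> bool" where
  "algebra_presheaf n X \<longleftrightarrow>
     (\<forall>U. openin (base X) U \<longrightarrow> Z2n_comm_algebra n (sections X U)) \<and>
     (\<forall>U V. openin (base X) U \<and> openin (base X) V \<and> V \<subseteq> U \<longrightarrow>
        restr X U V \<in> graded_algebra_hom n (sections X U) (sections X V)) \<and>
     (\<forall>U. openin (base X) U \<longrightarrow> (\<forall>s\<in>carrier (sections X U). restr X U U s = s)) \<and>
     (\<forall>U V W. openin (base X) U \<and> openin (base X) V \<and> openin (base X) W \<and> W \<subseteq> V \<and> V \<subseteq> U \<longrightarrow>
        (\<forall>s\<in>carrier (sections X U). restr X V W (restr X U V s) = restr X U W s))"

definition algebra_sheaf :: "nat \<Rightarrow> ('m, 'a) graded_space \<Rightarrow> bool" where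
  "algebra_sheaf n X \<longleftrightarrow>
     algebra_presheaf n X \<and>
     (\<forall>\<U>. (\<forall>U\<in>\<U>. openin (base X) U) \<longrightarrow>
        (\<forall>s. (\<forall>U\<in>\<U>. s U \<in> carrier (sections X U)) \<and>
             (\<forall>U\<in>\<U>. \<forall>V\<in>\<U>. restr X U (U \<inter> V) (s U) = restr X V (U \<inter> V) (s V)) \<longrightarrow>
             (\<exists>!t. t \<in> carrier (sections X (\<Union>\<U>)) \<and> (\<forall>U\<in>\<U>. restr X (\<Union>\<U>) U t = s U))))"

definition germ :: "('m, 'a) graded_space \<Rightarrow> 'm \<Rightarrow> 'm set \<Rightarrow> 'a \<Rightarrow> ('m set \<times> 'a) set" where
  "germ X m U s =
     {(V, t). openin (base X) V \<and> m \<in> V \<and> t \<in> carrier (sections X V) \<and>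
        (\<exists>W. openin (base X) W \<and> m \<in> W \<and> W \<subseteq> U \<inter> V \<and> restr X U W s = restr X V W t)}"

text \<open>Operations on germs are unions over all representatives, as for factor rings in the
  library; the operands of each union are all equal.\<close>

definition stalk :: "('m, 'a) graded_space \<Rightarrow> 'm \<Rightarrow> ('m set \<times> 'a) set graded_algebra" where
  "stalk X m =
     \<lparr>carrier = {germ X m U s | U s. openin (base X) U \<and> m \<in> U \<and> s \<in> carrier (sections X U)},
      mult = (\<lambda>g h. \<Union>(U, s)\<in>g. \<Union>(V, t)\<in>h. germ X m (U \<inter> V)
        (restr X U (U \<inter> V) s \<otimes>\<^bsub>sections X (U \<inter> V)\<^esub> restr X V (U \<inter> V) t)),
      one = germ X m (topspace (base X)) \<one>\<^bsub>sections X (topspace (base X))\<^esub>,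
      zero = germ X m (topspace (base X)) \<zero>\<^bsub>sections X (topspace (base X))\<^esub>,
      add = (\<lambda>g h. \<Union>(U, s)\<in>g. \<Union>(V, t)\<in>h. germ X m (U \<inter> V)
        (restr X U (U \<inter> V) s \<oplus>\<^bsub>sections X (U \<inter> V)\<^esub> restr X V (U \<inter> V) t)),
      smult = (\<lambda>c g. \<Union>(U, s)\<in>g. germ X m U (c \<odot>\<^bsub>sections X U\<^esub> s)),
      homog = (\<lambda>i. {germ X m U s | U s. openin (base X) U \<and> m \<in> U \<and> s \<in> homog (sections X U) i})\<rparr>"

definition stalk_ideal :: "nat \<Rightarrow> ('m, 'a) graded_space \<Rightarrow> 'm \<Rightarrow> ('m set \<times> 'a) set set" where
  "stalk_ideal n X m = (THE I. maximal_homogeneous_ideal n (stalk X m) I)"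

definition locally_Z2n_ringed_space :: "nat \<Rightarrow> ('m, 'a) graded_space \<Rightarrow> bool" where
  "locally_Z2n_ringed_space n X \<longleftrightarrow>
     Hausdorff_space (base X) \<and> second_countable (base X) \<and> algebra_sheaf n X \<and>
     (\<forall>m\<in>topspace (base X). local_graded_algebra n (stalk X m))"

text \<open>A morphism from \<open>X\<close> to \<open>Y\<close> is a continuous map \<open>\<phi>\<close> with pullbacks \<open>h V\<close> of
  sections over open \<open>V\<close> to sections over the preimage of \<open>V\<close>. The last clause says that
  the induced maps of stalks respect the maximal homogeneous ideals.\<close>

definition preim :: "('m, 'a) graded_space \<Rightarrow> ('m \<Rightarrow> 'n) \<Rightarrow> 'n set \<Rightarrow> 'm set" where
  "preim X \<phi> V = {x \<in> topspace (base X). \<phi> x \<in> V}"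

definition space_morphism ::
    "nat \<Rightarrow> ('m, 'a) graded_space \<Rightarrow> ('n, 'b) graded_space \<Rightarrow>
     ('m \<Rightarrow> 'n) \<Rightarrow> ('n set \<Rightarrow> 'b \<Rightarrow> 'a) \<Rightarrow> bool" where
  "space_morphism n X Y \<phi> h \<longleftrightarrow>
     continuous_map (base X) (base Y) \<phi> \<and>
     (\<forall>V. openin (base Y) V \<longrightarrow>
        h V \<in> graded_algebra_hom n (sections Y V) (sections X (preim X \<phi> V))) \<and>
     (\<forall>V W. openin (base Y) V \<and> openin (base Y) W \<and> W \<subseteq> V \<longrightarrow>
        (\<forall>s\<in>carrier (sections Y V).
           h W (restr Y V W s) = restr X (preim X \<phi> V) (preim X \<phi> W) (h V s))) \<and>
     (\<forall>x\<in>topspace (base X). \<forall>V. openin (base Y) V \<and> \<phi> x \<in> V \<longrightarrow>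
        (\<forall>s\<in>carrier (sections Y V).
           germ Y (\<phi> x) V s \<in> stalk_ideal n Y (\<phi> x) \<longrightarrow>
           germ X x (preim X \<phi> V) (h V s) \<in> stalk_ideal n X x))"

definition space_isomorphism ::
    "nat \<Rightarrow> ('m, 'a) graded_space \<Rightarrow> ('n, 'b) graded_space \<Rightarrow>
     ('m \<Rightarrow> 'n) \<Rightarrow> ('n set \<Rightarrow> 'b \<Rightarrow> 'a) \<Rightarrow> bool" where
  "space_isomorphism n X Y \<phi> h \<longleftrightarrow>
     space_morphism n X Y \<phi> h \<and>
     (\<exists>\<psi> g. space_morphism n Y X \<psi> g \<and>
        (\<forall>x\<in>topspace (base X). \<psi> (\<phi> x) = x) \<and>
        (\<forall>y\<in>topspace (base Y). \<phi> (\<psi> y) = y) \<and>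
        (\<forall>V. openin (base Y) V \<longrightarrow>
           (\<forall>s\<in>carrier (sections Y V). g (preim X \<phi> V) (h V s) = s)) \<and>
        (\<forall>U. openin (base X) U \<longrightarrow>
           (\<forall>s\<in>carrier (sections X U). h (preim Y \<psi> U) (g U s) = s)))"

definition open_subspace :: "('m, 'a) graded_space \<Rightarrow> 'm set \<Rightarrow> ('m, 'a) graded_space" where
  "open_subspace X W = X\<lparr>base := subtopology (base X) W\<rparr>"


section \<open>Superdomains\<close>

text \<open>$R^p$ is \<^term>\<open>Euclidean_space p\<close>, the sequences vanishing from index \<open>p\<close> on, so that
  \<open>p = 0\<close> is allowed.\<close>

type_synonym point = "nat \<Rightarrow> real"

primrec times_differentiable :: "nat \<Rightarrow> nat \<Rightarrow> point set \<Rightarrow> (point \<Rightarrow> real) \<Rightarrow> bool" where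
  "times_differentiable p 0 U f \<longleftrightarrow>
     continuous_map (subtopology (Euclidean_space p) U) euclideanreal f"
| "times_differentiable p (Suc r) U f \<longleftrightarrow>
     continuous_map (subtopology (Euclidean_space p) U) euclideanreal f \<and>
     (\<forall>i<p. \<exists>g. times_differentiable p r U g \<and>
        (\<forall>x\<in>U. ((\<lambda>t. f (x(i := t))) has_real_derivative g x) (at (x i))))"

definition smooth_fun :: "nat \<Rightarrow> point set \<Rightarrow> (point \<Rightarrow> real) \<Rightarrow> bool" where
  "smooth_fun p U f \<longleftrightarrow> (\<forall>r. times_differentiable p r U f)"

text \<open>There are \<open>q\<close> formal variables with indices \<open>a < q\<close>, the variable \<open>a\<close> having degree
  \<open>d a\<close>. A multi-index \<open>\<mu>\<close> stands for the ordered monomial in which the variables appear by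
  increasing index. A formal series is its family of coefficient functions.\<close>

type_synonym multiindex = "nat \<Rightarrow> nat"
type_synonym series = "multiindex \<Rightarrow> point \<Rightarrow> real"

definition variable_degrees :: "nat \<Rightarrow> nat \<Rightarrow> (nat \<Rightarrow> degree) \<Rightarrow> bool" where
  "variable_degrees n q d \<longleftrightarrow> (\<forall>a<q. d a \<in> Z2n n - {deg_zero})"

definition multiindices :: "nat \<Rightarrow> nat \<Rightarrow> (nat \<Rightarrow> degree) \<Rightarrow> multiindex set" where
  "multiindices n q d =
     {\<mu>. (\<forall>a\<ge>q. \<mu> a = 0) \<and> (\<forall>a<q. deg_dot n (d a) (d a) = 1 \<longrightarrow> \<mu> a \<le> 1)}"

definition monomial_degree :: "nat \<Rightarrow> (nat \<Rightarrow> degree) \<Rightarrow> multiindex \<Rightarrow> degree" where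
  "monomial_degree q d \<mu> = (\<lambda>k. \<Sum>a<q. of_nat (\<mu> a) * d a k)"

text \<open>Sign in $\xi^\mu \xi^\nu = \pm \xi^{\mu+\nu}$: each factor of $\xi^\nu$ moves to the left
  past the factors of $\xi^\mu$ of larger index.\<close>

definition monomial_sign :: "nat \<Rightarrow> nat \<Rightarrow> (nat \<Rightarrow> degree) \<Rightarrow> multiindex \<Rightarrow> multiindex \<Rightarrow> real" where
  "monomial_sign n q d \<mu> \<nu> = (\<Prod>a<q. \<Prod>b<a. deg_sign n (d a) (d b) ^ (\<mu> a * \<nu> b))"

definition series_mult :: "nat \<Rightarrow> nat \<Rightarrow> (nat \<Rightarrow> degree) \<Rightarrow> series \<Rightarrow> series \<Rightarrow> series" where
  "series_mult n q d f g = (\<lambda>\<rho> x.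
     if \<rho> \<in> multiindices n q d
     then \<Sum>(\<mu>, \<nu>) \<in> {(\<mu>, \<nu>). \<mu> \<in> multiindices n q d \<and> \<nu> \<in> multiindices n q d \<and> (\<lambda>a. \<mu> a + \<nu> a) = \<rho>}.
            monomial_sign n q d \<mu> \<nu> * f \<mu> x * g \<nu> x
     else 0)"

text \<open>To make a section over \<open>U\<close> unique, its coefficients vanish outside \<open>U\<close>, and those at
  inadmissible multi-indices are zero.\<close>

definition series_algebra ::
    "nat \<Rightarrow> nat \<Rightarrow> nat \<Rightarrow> (nat \<Rightarrow> degree) \<Rightarrow> point set \<Rightarrow> series graded_algebra" where
  "series_algebra n p q d U =
     (let S = {f. (\<forall>\<mu>. smooth_fun p U (f \<mu>)) \<and> (\<forall>\<mu> x. x \<notin> U \<longrightarrow> f \<mu> x = 0) \<and>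
                  (\<forall>\<mu> x. \<mu> \<notin> multiindices n q d \<longrightarrow> f \<mu> x = 0)}
      in \<lparr>carrier = S,
          mult = series_mult n q d,
          one = (\<lambda>\<mu> x. if \<mu> = (\<lambda>a. 0) \<and> x \<in> U then 1 else 0),
          zero = (\<lambda>\<mu> x. 0),
          add = (\<lambda>f g \<mu> x. f \<mu> x + g \<mu> x),
          smult = (\<lambda>c f \<mu> x. c * f \<mu> x),
          homog = (\<lambda>i. {f \<in> S. \<forall>\<mu>. monomial_degree q d \<mu> \<noteq> i \<longrightarrow> f \<mu> = (\<lambda>x. 0)})\<rparr>)"

definition superdomain ::
    "nat \<Rightarrow> nat \<Rightarrow> nat \<Rightarrow> (nat \<Rightarrow> degree) \<Rightarrow> point set \<Rightarrow> (point, series) graded_space" where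
  "superdomain n p q d U =
     \<lparr>base = subtopology (Euclidean_space p) U,
      sections = series_algebra n p q d,
      restr = (\<lambda>V W f \<mu> x. if x \<in> W then f \<mu> x else 0)\<rparr>"

text \<open>The dimension \<open>p|Q\<close>: \<open>Q k\<close> is the number of variables of the \<open>k\<close>-th nonzero degree,
  for \<open>k\<close> from 1 to $2^n - 1$. Other values of \<open>Q\<close> are not used.\<close>

definition superdomain_of_dim ::
    "nat \<Rightarrow> nat \<Rightarrow> (nat \<Rightarrow> nat) \<Rightarrow> nat \<Rightarrow> (nat \<Rightarrow> degree) \<Rightarrow> point set \<Rightarrow> bool" where
  "superdomain_of_dim n p Q q d U \<longleftrightarrow>
     openin (Euclidean_space p) U \<and> variable_degrees n q d \<and>
     (\<forall>k. 1 \<le> k \<and> k < 2 ^ n \<longrightarrow> Q k = card {a. a < q \<and> d a = lex_degree n k})"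


section \<open>Supermanifolds\<close>

definition Z2n_supermanifold ::
    "nat \<Rightarrow> nat \<Rightarrow> (nat \<Rightarrow> nat) \<Rightarrow> ('m, 'a) graded_space \<Rightarrow> bool" where
  "Z2n_supermanifold n p Q X \<longleftrightarrow>
     locally_Z2n_ringed_space n X \<and>
     (\<forall>m\<in>topspace (base X). \<exists>W q d U \<phi> h.
        openin (base X) W \<and> m \<in> W \<and> superdomain_of_dim n p Q q d U \<and>
        space_isomorphism n (open_subspace X W) (superdomain n p q d U) \<phi> h)"

definition convex_points :: "point set \<Rightarrow> bool" where
  "convex_points U \<longleftrightarrow>
     (\<forall>x\<in>U. \<forall>y\<in>U. \<forall>t. 0 \<le> t \<and> t \<le> 1 \<longrightarrow> (\<lambda>i. (1 - t) * x i + t * y i) \<in> U)"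

text \<open>The chart is defined on the open set \<open>W\<close>, and \<open>V\<close> is the coordinate domain.\<close>

definition centered_coordinates ::
    "nat \<Rightarrow> nat \<Rightarrow> (nat \<Rightarrow> nat) \<Rightarrow> ('m, 'a) graded_space \<Rightarrow> 'm \<Rightarrow> 'm set \<Rightarrow>
     nat \<Rightarrow> (nat \<Rightarrow> degree) \<Rightarrow> point set \<Rightarrow>
     ('m \<Rightarrow> point) \<Rightarrow> (point set \<Rightarrow> series \<Rightarrow> 'a) \<Rightarrow> bool" where
  "centered_coordinates n p Q X m W q d V \<phi> h \<longleftrightarrow>
     openin (base X) W \<and> m \<in> W \<and>
     superdomain_of_dim n p Q q d V \<and> convex_points V \<and>
     space_isomorphism n (open_subspace X W) (superdomain n p q d V) \<phi> h \<and>
     \<phi> m = (\<lambda>i. 0)"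

definition polynomial_on :: "nat \<Rightarrow> point set \<Rightarrow> (point \<Rightarrow> real) \<Rightarrow> bool" where
  "polynomial_on p U f \<longleftrightarrow>
     (\<exists>(S :: multiindex set) c. finite S \<and> (\<forall>x\<in>U. f x = (\<Sum>\<alpha>\<in>S. c \<alpha> * (\<Prod>i<p. x i ^ \<alpha> i))))"

text \<open>Polynomials may have infinitely many nonzero coefficients in the formal variables.\<close>

definition polynomial_sections ::
    "nat \<Rightarrow> nat \<Rightarrow> nat \<Rightarrow> (nat \<Rightarrow> degree) \<Rightarrow> point set \<Rightarrow> series set" where
  "polynomial_sections n p q d U =
     {P \<in> carrier (sections (superdomain n p q d U) U). \<forall>\<mu>. polynomial_on p U (P \<mu>)}"

text \<open>The library's product of ideals consists of finite sums of products of elements, and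
  \<^term>\<open>ideals_set R\<close> is the multiplicative structure on ideals it defines.\<close>

definition ideal_power :: "'a graded_algebra \<Rightarrow> 'a set \<Rightarrow> nat \<Rightarrow> 'a set" where
  "ideal_power A I k = I [^]\<^bsub>ideals_set A\<^esub> k"

end

theory Submission
  imports Defs
begin

text \<open>On a cube around the origin, Hadamard's lemma writes the coefficient of the trivial monomial of
  a series \<open>F\<close> as a constant plus a combination of the base coordinates; splitting the last formal
  variable off every other monomial gives \<open>F = c + \<Sum> D\<^sub>i x\<^sub>i + \<Sum> G\<^sub>a \<xi>\<^sub>a\<close>. Approximating the
  \<open>D\<^sub>i\<close> and \<open>G\<^sub>a\<close> modulo the \<open>k\<close>-th power of an ideal containing all coordinates approximates \<open>F\<close>
  modulo the next power, so the claim follows by induction on \<open>k\<close>, without Taylor expansions.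
  It remains to see that the coordinates lie in the maximal homogeneous ideal of the stalk. The
  evaluation of germs at the point, defined through the inverse chart, is a homomorphism onto the
  reals; its kernel is a maximal homogeneous ideal, hence the unique one, and it contains the
  coordinates.\<close>

section \<open>Smooth functions\<close>

text \<open>A series has infinitely many monomials, but one division step produces only
  \<open>p + q\<close> products, because each nontrivial monomial is charged to its last variable;
  no infinite sum ever has to be placed in an ideal. The induction starts at \<open>k = 0\<close>
  with the zero polynomial, so the approximant reached at \<open>k\<close> has total degree below
  \<open>k\<close> in \<open>x\<close> and \<xi>.

  Two obstacles shape the rest. A function near \<open>m\<close> becomes a series only on a small
  neighbourhood of the origin, whereas the polynomial has to be a section over all of
  \<open>V\<close>; the two are compared as germs, and Hadamard's lemma keeps the cube fixed, so one
  cube serves the whole induction. Differentiability is given by iterated partial derivatives, so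
  only one coordinate is moved at a time, and the domain must be stable under scaling single
  coordinates. Locality of the stalks belongs to the definition of the space; it is therefore enough
  to exhibit one maximal homogeneous ideal.\<close>

lemma continuous_map_Euclidean_iff:
  assumes "U \<subseteq> topspace (Euclidean_space p)"
  shows "continuous_map (subtopology (Euclidean_space p) U) euclideanreal f \<longleftrightarrow> continuous_on U f"
proof -
  \<comment> \<open>The type \<open>point\<close> itself carries the product topology, so
    \<open>Euclidean_space p\<close> is a subspace of it, and the continuity lemmas for types become
    available on \<open>U\<close>.\<close>
  have "subtopology (Euclidean_space p) U = top_of_set U"
    using assms
    by (simp add: Euclidean_space_def subtopology_subtopology topspace_Euclidean_space
        euclidean_product_topology inf_absorb2)
  then show ?thesis by simp
qed

lemma continuous_on_fun_upd: "continuous_on S (\<lambda>t::real. (x::point)(i := t))"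
proof (rule continuous_on_coordinatewise_then_product)
  show "continuous_on S (\<lambda>t. (x(i := t)) j)" for j
    by (cases "j = i") auto
qed

lemma open_slice:
  assumes "openin (Euclidean_space p) U" "i < p"
  shows "open {t. x(i := t) \<in> U}"
proof -
  obtain T where T: "open T" "U = T \<inter> {x. \<forall>i\<ge>p. x i = 0}"
    using assms(1) by (auto simp: Euclidean_space_def openin_subtopology euclidean_product_topology)
  have "continuous_on UNIV (\<lambda>t. x(i := t))"
    by (rule continuous_on_fun_upd)
  then have *: "open ((\<lambda>t. x(i := t)) -` T)"
    using T(1) by (rule open_vimage[rotated])
  show ?thesis
  proof (cases "\<forall>j\<ge>p. x j = 0")
    case True
    then have "{t. x(i := t) \<in> U} = (\<lambda>t. x(i := t)) -` T"
      using assms(2) by (auto simp: T(2))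
    then show ?thesis using * by simp
  next
    case False
    \<comment> \<open>Changing a coordinate \<open>i < p\<close> cannot repair a nonzero entry at an
      index from \<open>p\<close> on.\<close>
    then have "{t. x(i := t) \<in> U} = {}"
      using assms(2) by (auto simp: T(2))
    then show ?thesis by (metis open_empty)
  qed
qed

text \<open>A derivative at \<open>x i\<close> sees only nearby \<open>t\<close>, and by
  \<open>open_slice\<close> the points \<open>x(i := t)\<close> stay in \<open>U\<close> for
  these.\<close>

lemma has_real_derivative_slice_cong:
  assumes "openin (Euclidean_space p) U" "i < p" "x \<in> U" "\<And>y. y \<in> U \<Longrightarrow> f y = g y"
    and "((\<lambda>t. f (x(i := t))) has_real_derivative D) (at (x i))"
  shows "((\<lambda>t. g (x(i := t))) has_real_derivative D) (at (x i))"
  by (rule DERIV_cong_ev[THEN iffD1, OF refl _ refl assms(5)])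
     (use assms in \<open>auto intro!: eventually_nhds_in_open[THEN eventually_mono, OF open_slice[OF assms(1,2)]]\<close>)

lemma times_differentiable_imp_continuous:
  "times_differentiable p r U f \<Longrightarrow> continuous_map (subtopology (Euclidean_space p) U) euclideanreal f"
  by (cases r) auto

lemma times_differentiable_partial:
  assumes "times_differentiable p (Suc r) U f" "i < p"
  obtains g where "times_differentiable p r U g"
    "\<And>x. x \<in> U \<Longrightarrow> ((\<lambda>t. f (x(i := t))) has_real_derivative g x) (at (x i))"
  using assms by auto

lemma times_differentiable_SucD:
  "times_differentiable p (Suc r) U f \<Longrightarrow> times_differentiable p r U f"
proof (induction r arbitrary: f)
  case (Suc r)
  then show ?case by (metis times_differentiable.simps(2))
qed auto

text \<open>Sections over \<open>U\<close> are cut off by 0 outside \<open>U\<close>, so a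
  coefficient often agrees with a visibly smooth function only on \<open>U\<close>. Openness of
  \<open>U\<close> makes this enough.\<close>

lemma times_differentiable_cong:
  assumes U: "openin (Euclidean_space p) U" and eq: "\<And>x. x \<in> U \<Longrightarrow> f x = g x"
    and f: "times_differentiable p r U f"
  shows "times_differentiable p r U g"
proof -
  have "continuous_map (subtopology (Euclidean_space p) U) euclideanreal g"
    using times_differentiable_imp_continuous[OF f] by (rule continuous_map_eq) (use eq in auto)
  moreover have "\<exists>g'. times_differentiable p s U g' \<and>
      (\<forall>x\<in>U. ((\<lambda>t. g (x(i := t))) has_real_derivative g' x) (at (x i)))"
    if r: "r = Suc s" and i: "i < p" for s i
  proof -
    obtain f' where "times_differentiable p s U f'"
      "\<And>x. x \<in> U \<Longrightarrow> ((\<lambda>t. f (x(i := t))) has_real_derivative f' x) (at (x i))"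
      using times_differentiable_partial[OF f[unfolded r] i] by blast
    then show ?thesis
      using has_real_derivative_slice_cong[OF U i, of _ f g] eq by blast
  qed
  ultimately show ?thesis by (cases r) auto
qed

lemma times_differentiable_const: "times_differentiable p r U (\<lambda>x. c)"
proof (induction r arbitrary: c)
  case (Suc r)
  then show ?case by (auto intro!: exI[of _ "\<lambda>x. 0"])
qed auto

lemma times_differentiable_coord: "times_differentiable p r U (\<lambda>x. x i)"
proof -
  have cont: "continuous_map (subtopology (Euclidean_space p) U) euclideanreal (\<lambda>x. x i)"
    unfolding Euclidean_space_def
    using continuous_map_product_projection[of i UNIV "\<lambda>_. euclideanreal"]
    by (intro continuous_map_from_subtopology) simp
  have D: "((\<lambda>t. (x(j := t)) i) has_real_derivative (if j = i then 1 else 0)) (at (x j))" for x :: point and j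
    by auto
  show ?thesis
  proof (cases r)
    case (Suc s)
    have "\<exists>g. times_differentiable p s U g \<and>
        (\<forall>x\<in>U. ((\<lambda>t. (x(j := t)) i) has_real_derivative g x) (at (x j)))" for j
      using D times_differentiable_const[of p s U "if j = i then 1 else 0"]
      by (intro exI[of _ "\<lambda>x. if j = i then 1 else 0"]) simp
    then show ?thesis unfolding Suc times_differentiable.simps using cont by blast
  qed (use cont in simp)
qed

lemma times_differentiable_add:
  assumes "times_differentiable p r U f" "times_differentiable p r U g"
  shows "times_differentiable p r U (\<lambda>x. f x + g x)"
  using assms
proof (induction r arbitrary: f g)
  case 0
  then show ?case by (auto intro: continuous_map_add)
next
  case (Suc r)
  have "\<exists>d. times_differentiable p r U d \<and>
      (\<forall>x\<in>U. ((\<lambda>t. f (x(i := t)) + g (x(i := t))) has_real_derivative d x) (at (x i)))"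
    if i: "i < p" for i
  proof -
    obtain f' where "times_differentiable p r U f'"
      "\<And>x. x \<in> U \<Longrightarrow> ((\<lambda>t. f (x(i := t))) has_real_derivative f' x) (at (x i))"
      using times_differentiable_partial[OF Suc.prems(1) i] by blast
    moreover obtain g' where "times_differentiable p r U g'"
      "\<And>x. x \<in> U \<Longrightarrow> ((\<lambda>t. g (x(i := t))) has_real_derivative g' x) (at (x i))"
      using times_differentiable_partial[OF Suc.prems(2) i] by blast
    ultimately show ?thesis
      by (intro exI[of _ "\<lambda>x. f' x + g' x"]) (auto intro: Suc.IH DERIV_add)
  qed
  then show ?case using Suc.prems by (auto intro: continuous_map_add)
qed

lemma times_differentiable_mult:
  assumes "times_differentiable p r U f" "times_differentiable p r U g"
  shows "times_differentiable p r U (\<lambda>x. f x * g x)"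
  using assms
proof (induction r arbitrary: f g)
  case 0
  then show ?case by (auto intro: continuous_map_real_mult)
next
  case (Suc r)
  have "\<exists>d. times_differentiable p r U d \<and>
      (\<forall>x\<in>U. ((\<lambda>t. f (x(i := t)) * g (x(i := t))) has_real_derivative d x) (at (x i)))"
    if i: "i < p" for i
  proof -
    obtain f' where f': "times_differentiable p r U f'"
      "\<And>x. x \<in> U \<Longrightarrow> ((\<lambda>t. f (x(i := t))) has_real_derivative f' x) (at (x i))"
      using times_differentiable_partial[OF Suc.prems(1) i] by blast
    obtain g' where g': "times_differentiable p r U g'"
      "\<And>x. x \<in> U \<Longrightarrow> ((\<lambda>t. g (x(i := t))) has_real_derivative g' x) (at (x i))"
      using times_differentiable_partial[OF Suc.prems(2) i] by blast
    have "((\<lambda>t. f (x(i := t)) * g (x(i := t))) has_real_derivative f' x * g x + g' x * f x) (at (x i))"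
      if "x \<in> U" for x
      using DERIV_mult[OF f'(2)[OF that] g'(2)[OF that]] by simp
    moreover have "times_differentiable p r U (\<lambda>x. f' x * g x + g' x * f x)"
      using Suc.prems[THEN times_differentiable_SucD] f'(1) g'(1)
      by (intro times_differentiable_add Suc.IH) auto
    ultimately show ?thesis by blast
  qed
  then show ?case using Suc.prems by (auto intro: continuous_map_real_mult)
qed

lemma smooth_fun_cong:
  "openin (Euclidean_space p) U \<Longrightarrow> (\<And>x. x \<in> U \<Longrightarrow> f x = g x) \<Longrightarrow> smooth_fun p U f \<Longrightarrow> smooth_fun p U g"
  unfolding smooth_fun_def by (blast intro: times_differentiable_cong)

lemma smooth_fun_const: "smooth_fun p U (\<lambda>x. c)"
  unfolding smooth_fun_def by (blast intro: times_differentiable_const)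

lemma smooth_fun_coord: "smooth_fun p U (\<lambda>x. x i)"
  unfolding smooth_fun_def by (blast intro: times_differentiable_coord)

lemma smooth_fun_add: "smooth_fun p U f \<Longrightarrow> smooth_fun p U g \<Longrightarrow> smooth_fun p U (\<lambda>x. f x + g x)"
  unfolding smooth_fun_def by (blast intro: times_differentiable_add)

lemma smooth_fun_mult: "smooth_fun p U f \<Longrightarrow> smooth_fun p U g \<Longrightarrow> smooth_fun p U (\<lambda>x. f x * g x)"
  unfolding smooth_fun_def by (blast intro: times_differentiable_mult)

text \<open>The definition provides a separate partial derivative for every order \<open>r\<close>.
  Derivatives are unique, so all of them agree on \<open>U\<close> and the one for
  \<open>r = 0\<close> is smooth.\<close>

lemma smooth_fun_partial:
  assumes U: "openin (Euclidean_space p) U" and f: "smooth_fun p U f" and i: "i < p"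
  obtains g where "smooth_fun p U g"
    "\<And>x. x \<in> U \<Longrightarrow> ((\<lambda>t. f (x(i := t))) has_real_derivative g x) (at (x i))"
proof -
  have "\<exists>g. times_differentiable p r U g \<and>
      (\<forall>x\<in>U. ((\<lambda>t. f (x(i := t))) has_real_derivative g x) (at (x i)))" for r
    using times_differentiable_partial[OF _ i] f unfolding smooth_fun_def by metis
  then obtain g where g: "\<And>r. times_differentiable p r U (g r)"
    "\<And>r x. x \<in> U \<Longrightarrow> ((\<lambda>t. f (x(i := t))) has_real_derivative g r x) (at (x i))"
    by metis
  have "g r x = g 0 x" if "x \<in> U" for r x
    using g(2) that DERIV_unique by blast
  then have "smooth_fun p U (g 0)"
    unfolding smooth_fun_def using times_differentiable_cong[OF U _ g(1)] by blast
  then show ?thesis using that g(2) by blast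
qed

section \<open>Cubes, parameter integrals and Hadamard's lemma\<close>

definition cube :: "nat \<Rightarrow> real \<Rightarrow> point set" where
  "cube p r = {x. (\<forall>i<p. \<bar>x i\<bar> < r) \<and> (\<forall>i\<ge>p. x i = 0)}"

lemma openin_cube: "openin (Euclidean_space p) (cube p r)"
proof -
  have "open (\<Inter>i\<in>{..<p}. (\<lambda>x::point. x i) -` {-r<..<r})"
    by (intro open_INT ballI open_vimage) auto
  moreover have "cube p r = (\<Inter>i\<in>{..<p}. (\<lambda>x::point. x i) -` {-r<..<r}) \<inter> {x. \<forall>i\<ge>p. x i = 0}"
    by (auto simp: cube_def abs_less_iff)
  ultimately show ?thesis
    unfolding Euclidean_space_def openin_subtopology euclidean_product_topology open_openin[symmetric]
    by blast
qed

lemma cube_neighbourhood: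
  assumes "openin (Euclidean_space p) U" "(\<lambda>i. 0) \<in> U"
  obtains r where "r > 0" "cube p r \<subseteq> U"
proof -
  obtain T where T: "open T" "U = T \<inter> {x. \<forall>i\<ge>p. x i = 0}"
    using assms(1) by (auto simp: Euclidean_space_def openin_subtopology euclidean_product_topology)
  have "(\<lambda>i. 0) \<in> T" using assms(2) T by auto
  then obtain Y where Y: "(\<lambda>i. 0) \<in> Pi\<^sub>E UNIV Y" "\<And>i. open (Y i)" "Pi\<^sub>E UNIV Y \<subseteq> T"
    using product_topology_open_contains_basis[of "\<lambda>_. euclidean" UNIV T "\<lambda>i. 0 :: real"] T(1)
    by (auto simp: euclidean_product_topology open_openin[symmetric])
  have "\<exists>e>0. \<forall>t. \<bar>t\<bar> < e \<longrightarrow> t \<in> Y i" for i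
  proof -
    have "0 \<in> Y i" using Y(1) by auto
    then obtain e where "e > 0" "ball 0 e \<subseteq> Y i" using Y(2) openE by blast
    then show ?thesis by (intro exI[of _ e]) (auto simp: subset_iff)
  qed
  then obtain e where e: "\<And>i. e i > 0" "\<And>i t. \<bar>t\<bar> < e i \<Longrightarrow> t \<in> Y i" by metis
  \<comment> \<open>Only the first \<open>p\<close> coordinates of a point of the cube can be
    nonzero, so a minimum of finitely many radii suffices. The 1 keeps the set nonempty when
    \<open>p = 0\<close>.\<close>
  define r where "r = Min (insert 1 (e ` {..<p}))"
  have "r > 0" unfolding r_def using e(1) by (subst Min_gr_iff) auto
  have re: "r \<le> e i" if "i < p" for i unfolding r_def using that by (intro Min_le) auto
  have "cube p r \<subseteq> U"
  proof
    fix x assume x: "x \<in> cube p r"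
    have "x i \<in> Y i" for i
      using x re[of i] e(1)[of i] by (intro e(2)) (cases "i < p"; force simp: cube_def)
    then show "x \<in> U" using Y(3) x by (auto simp: T(2) cube_def)
  qed
  then show ?thesis using that \<open>r > 0\<close> by blast
qed

text \<open>The reason for working on cubes: each coordinate may be shrunk by its own factor,
  whereas convexity would only allow a common factor towards the origin.\<close>

lemma cube_scale:
  assumes "x \<in> cube p r" "\<And>l. 0 \<le> w l" "\<And>l. w l \<le> 1"
  shows "(\<lambda>l. w l * x l) \<in> cube p r"
proof -
  have "\<bar>w l * x l\<bar> < r" if "l < p" for l
  proof -
    have "\<bar>w l * x l\<bar> \<le> 1 * \<bar>x l\<bar>"
      unfolding abs_mult using assms(2,3) by (intro mult_right_mono) auto
    then show ?thesis using assms(1) that by (auto simp: cube_def)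
  qed
  then show ?thesis using assms(1) by (auto simp: cube_def)
qed

text \<open>The map \<open>y\<close> is left general because two cases are needed: the identity, for
  continuity in the whole point, and a coordinate line \<open>x(i := u)\<close>, for differentiation
  under the integral.\<close>

lemma continuous_on_cube_scaled:
  fixes g :: "point \<Rightarrow> real" and w :: "nat \<Rightarrow> real \<Rightarrow> real"
  assumes g: "continuous_on (cube p r) g"
    and w: "\<And>l. continuous_on {0..1} (w l)" "\<And>l t. t \<in> {0..1} \<Longrightarrow> w l t \<in> {0..1}"
    and y: "continuous_on S y" "y ` S \<subseteq> cube p r"
  shows "continuous_on (S \<times> {0..1}) (\<lambda>(s, t). g (\<lambda>l. w l t * y s l))"
proof -
  have "continuous_on (S \<times> {0..1}) (\<lambda>st. g ((\<lambda>st l. w l (snd st) * y (fst st) l) st))"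
  proof (rule continuous_on_compose2[OF g])
    have "continuous_on (S \<times> {0..1}) (\<lambda>st. w l (snd st))" for l
      by (rule continuous_on_compose2[OF w(1) continuous_on_snd]) auto
    moreover have "continuous_on (S \<times> {0..1}) (\<lambda>st. y (fst st) l)" for l
      by (rule continuous_on_compose2[OF continuous_on_product_then_coordinatewise[OF y(1)] continuous_on_fst])
         auto
    ultimately show "continuous_on (S \<times> {0..1}) (\<lambda>st l. w l (snd st) * y (fst st) l)"
      by (intro continuous_on_coordinatewise_then_product continuous_on_mult) auto
    show "(\<lambda>st l. w l (snd st) * y (fst st) l) ` (S \<times> {0..1}) \<subseteq> cube p r"
      using w(2) y(2) by (auto intro!: cube_scale)
  qed
  then show ?thesis by (simp add: case_prod_beta)
qed

text \<open>Differentiating under the integral in direction \<open>i\<close> brings out the inner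
  derivative \<open>w i t\<close>. The result is an integral of the same kind with weight
  \<open>c t * w i t\<close> and a partial derivative of \<open>g\<close>; the weight
  \<open>c\<close> is there to make the induction on the order close.\<close>

lemma times_differentiable_integral_scaled:
  fixes w :: "nat \<Rightarrow> real \<Rightarrow> real"
  assumes "times_differentiable p s (cube p r) g"
    and c: "continuous_on {0..1} c"
    and w: "\<And>l. continuous_on {0..1} (w l)" "\<And>l t. t \<in> {0..1} \<Longrightarrow> w l t \<in> {0..1}"
  shows "times_differentiable p s (cube p r) (\<lambda>x. integral {0..1} (\<lambda>t. c t * g (\<lambda>l. w l t * x l)))"
  using assms(1) c
proof (induction s arbitrary: g c)
  let ?B = "cube p r"
  have sub: "?B \<subseteq> topspace (Euclidean_space p)"
    using openin_subset[OF openin_cube] .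
  have cont: "continuous_on ?B (\<lambda>x. integral {0..1} (\<lambda>t. c t * g (\<lambda>l. w l t * x l)))"
    if "continuous_on ?B g" "continuous_on {0..1} c" for c :: "real \<Rightarrow> real" and g :: "point \<Rightarrow> real"
  proof -
    have "continuous_on (?B \<times> {0..1}) (\<lambda>(x, t). g (\<lambda>l. w l t * x l))"
      using continuous_on_cube_scaled[OF that(1) w continuous_on_id] by simp
    moreover have "continuous_on (?B \<times> {0..1}) (\<lambda>xt. c (snd xt))"
      by (rule continuous_on_compose2[OF that(2) continuous_on_snd]) auto
    ultimately have "continuous_on (?B \<times> cbox 0 1) (\<lambda>(x, t). c t * g (\<lambda>l. w l t * x l))"
      by (auto intro: continuous_on_mult simp: case_prod_beta)
    from integral_continuous_on_param[OF this] show ?thesis by simp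
  qed
  {
    case 0
    then show ?case using cont by (simp add: continuous_map_Euclidean_iff[OF sub])
  next
    case (Suc s)
    have g: "continuous_on ?B g"
      using Suc.prems by (simp add: continuous_map_Euclidean_iff[OF sub])
    have "\<exists>G. times_differentiable p s ?B G \<and> (\<forall>x\<in>?B.
        ((\<lambda>u. integral {0..1} (\<lambda>t. c t * g (\<lambda>l. w l t * (x(i := u)) l))) has_real_derivative G x) (at (x i)))"
      if i: "i < p" for i
    proof -
      obtain g' where g': "times_differentiable p s ?B g'"
        "\<And>x. x \<in> ?B \<Longrightarrow> ((\<lambda>t. g (x(i := t))) has_real_derivative g' x) (at (x i))"
        using times_differentiable_partial[OF Suc.prems(1) i] by blast
      have g'c: "continuous_on ?B g'"
        using times_differentiable_imp_continuous[OF g'(1)] by (simp add: continuous_map_Euclidean_iff[OF sub])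
      have cw: "continuous_on {0..1} (\<lambda>t. c t * w i t)"
        using Suc.prems(2) w(1) by (rule continuous_on_mult)
      have "((\<lambda>u. integral {0..1} (\<lambda>t. c t * g (\<lambda>l. w l t * (x(i := u)) l))) has_real_derivative
          integral {0..1} (\<lambda>t. c t * w i t * g' (\<lambda>l. w l t * x l))) (at (x i))" if x: "x \<in> ?B" for x
      proof -
        have xu: "x(i := u) \<in> ?B" if "u \<in> {-r<..<r}" for u
          using x i that by (auto simp: cube_def)
        have xi: "x i \<in> {-r<..<r}" using x i by (auto simp: cube_def abs_less_iff)
        have yc: "continuous_on {-r<..<r} (\<lambda>u. x(i := u))"
          by (rule continuous_on_fun_upd)
        have "((\<lambda>u. integral (cbox 0 1) (\<lambda>t. c t * g (\<lambda>l. w l t * (x(i := u)) l))) has_real_derivative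
          integral (cbox 0 1) (\<lambda>t. c t * w i t * g' (\<lambda>l. w l t * (x(i := x i)) l))) (at (x i) within {-r<..<r})"
        proof (rule leibniz_rule_field_derivative)
          fix u t :: real assume u: "u \<in> {-r<..<r}" and t: "t \<in> cbox 0 1"
          let ?z = "\<lambda>l. w l t * (x(i := u)) l"
          have "?z \<in> ?B" using cube_scale[OF xu[OF u], of "\<lambda>l. w l t"] w(2)[of t] t by auto
          from g'(2)[OF this] have "((\<lambda>v. g (?z(i := v))) has_real_derivative g' ?z) (at (w i t * u))" by simp
          \<comment> \<open>Varying \<open>x i\<close> moves the scaled point in coordinate
            \<open>i\<close> alone, so the chain rule in one variable is all that is needed.\<close>
          then have "((\<lambda>v. g (?z(i := w i t * v))) has_real_derivative g' ?z * w i t) (at u)"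
            by (rule DERIV_chain2) (auto intro!: derivative_eq_intros)
          moreover have "?z(i := w i t * v) = (\<lambda>l. w l t * (x(i := v)) l)" for v
            by auto
          ultimately have "((\<lambda>v. g (\<lambda>l. w l t * (x(i := v)) l)) has_real_derivative g' ?z * w i t) (at u)"
            by simp
          from has_field_derivative_at_within[OF DERIV_cmult[OF this, of "c t"]]
          show "((\<lambda>v. c t * g (\<lambda>l. w l t * (x(i := v)) l)) has_real_derivative c t * w i t * g' ?z)
              (at u within {-r<..<r})"
            by (simp add: mult_ac)
        next
          fix u :: real assume u: "u \<in> {-r<..<r}"
          have "continuous_on ({u} \<times> {0..1}) (\<lambda>(s, t). g (\<lambda>l. w l t * (x(i := s)) l))"
            by (rule continuous_on_cube_scaled[OF g w continuous_on_subset[OF yc]]) (use u xu in auto)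
          then have "continuous_on {0..1} (\<lambda>t. (\<lambda>(s, t). g (\<lambda>l. w l t * (x(i := s)) l)) (u, t))"
            by (rule continuous_on_compose2) (auto intro!: continuous_intros)
          then have "continuous_on {0..1} (\<lambda>t. g (\<lambda>l. w l t * (x(i := u)) l))" by simp
          then show "(\<lambda>t. c t * g (\<lambda>l. w l t * (x(i := u)) l)) integrable_on cbox 0 1"
            using Suc.prems(2) by (intro integrable_continuous) (auto intro: continuous_on_mult)
        next
          have "continuous_on ({-r<..<r} \<times> {0..1}) (\<lambda>(s, t). g' (\<lambda>l. w l t * (x(i := s)) l))"
            by (rule continuous_on_cube_scaled[OF g'c w yc]) (use xu in auto)
          moreover have "continuous_on ({-r<..<r} \<times> {0..1}) (\<lambda>st. c (snd st) * w i (snd st))"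
            by (rule continuous_on_compose2[OF cw continuous_on_snd]) auto
          ultimately show "continuous_on ({-r<..<r} \<times> cbox 0 1) (\<lambda>(u, t). c t * w i t * g' (\<lambda>l. w l t * (x(i := u)) l))"
            by (auto intro: continuous_on_mult simp: case_prod_beta)
        qed (use xi in auto)
        then show ?thesis using at_within_open[OF xi open_greaterThanLessThan] by simp
      qed
      moreover have "times_differentiable p s ?B (\<lambda>x. integral {0..1} (\<lambda>t. c t * w i t * g' (\<lambda>l. w l t * x l)))"
        by (rule Suc.IH[OF g'(1) cw])
      ultimately show ?thesis
        by (intro exI[of _ "\<lambda>x. integral {0..1} (\<lambda>t. c t * w i t * g' (\<lambda>l. w l t * x l))"] conjI ballI)
    qed
    then show ?case using cont[OF g Suc.prems(2)] by (simp add: continuous_map_Euclidean_iff[OF sub])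
  }
qed

text \<open>The segment from 0 to \<open>x\<close> is replaced by a path through the points whose coordinates from
  some index on are set to 0; along each piece only one partial derivative is involved.\<close>

lemma hadamard_cube:
  assumes f: "smooth_fun p (cube p r) f" and r: "r > 0"
  obtains F where "\<And>i. i < p \<Longrightarrow> smooth_fun p (cube p r) (F i)"
    "\<And>x. x \<in> cube p r \<Longrightarrow> f x = f (\<lambda>i. 0) + (\<Sum>i<p. F i x * x i)"
proof -
  let ?B = "cube p r"
  have sub: "?B \<subseteq> topspace (Euclidean_space p)"
    using openin_subset[OF openin_cube] .
  have "\<exists>g. smooth_fun p ?B g \<and>
      (\<forall>x\<in>?B. ((\<lambda>t. f (x(i := t))) has_real_derivative g x) (at (x i)))" if "i < p" for i
    using smooth_fun_partial[OF openin_cube f that] by metis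
  then obtain g where g: "\<And>i. i < p \<Longrightarrow> smooth_fun p ?B (g i)"
    "\<And>i x. i < p \<Longrightarrow> x \<in> ?B \<Longrightarrow> ((\<lambda>t. f (x(i := t))) has_real_derivative g i x) (at (x i))"
    by metis
  \<comment> \<open>Scaling factors for the \<open>i\<close>-th piece of the path: coordinates below
    \<open>i\<close> have their final value, coordinate \<open>i\<close> is growing, those above are
    still 0.\<close>
  define w :: "nat \<Rightarrow> nat \<Rightarrow> real \<Rightarrow> real" where
    "w i l t = (if l < i then 1 else if l = i then t else 0)" for i l t
  \<comment> \<open>The factor 1 is the constant weight with which
    \<open>times_differentiable_integral_scaled\<close> is applied.\<close>
  define F where "F i x = integral {0..1} (\<lambda>t. 1 * g i (\<lambda>l. w i l t * x l))" for i x
  have wc: "continuous_on {0..1} (w i l)" for i l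
    by (cases l i rule: linorder_cases) (auto simp: w_def[abs_def])
  have w01: "w i l t \<in> {0..1}" if "t \<in> {0..1}" for i l t
    using that by (auto simp: w_def)
  have "smooth_fun p ?B (F i)" if "i < p" for i
    unfolding smooth_fun_def F_def
    using g(1)[OF that] wc w01
    by (intro allI times_differentiable_integral_scaled) (auto simp: smooth_fun_def)
  moreover have "f x = f (\<lambda>i. 0) + (\<Sum>i<p. F i x * x i)" if x: "x \<in> ?B" for x
  proof -
    define y where "y j l = (if l < j then x l else 0)" for j l :: nat
    have step: "f (y (Suc i)) - f (y i) = F i x * x i" if i: "i < p" for i
    proof -
      define \<gamma> where "\<gamma> t = (\<lambda>l. w i l t * x l)" for t
      have "((\<lambda>t. g i (\<gamma> t) * x i) has_integral f (\<gamma> 1) - f (\<gamma> 0)) {0..1}"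
      proof (rule fundamental_theorem_of_calculus)
        fix t :: real assume t: "t \<in> {0..1}"
        have "\<gamma> t \<in> ?B" unfolding \<gamma>_def using x w01[OF t] by (intro cube_scale) auto
        from g(2)[OF i this]
        have "((\<lambda>s. f ((\<gamma> t)(i := s))) has_real_derivative g i (\<gamma> t)) (at (t * x i))"
          by (simp add: \<gamma>_def w_def)
        then have "((\<lambda>s. f ((\<gamma> t)(i := s * x i))) has_real_derivative g i (\<gamma> t) * x i) (at t)"
          by (rule DERIV_chain2) (auto intro!: derivative_eq_intros)
        moreover have "(\<gamma> t)(i := s * x i) = \<gamma> s" for s
          by (auto simp: \<gamma>_def w_def)
        ultimately show "((\<lambda>s. f (\<gamma> s)) has_vector_derivative g i (\<gamma> t) * x i) (at t within {0..1})"
          by (simp add: has_real_derivative_iff_has_vector_derivative[symmetric] has_field_derivative_at_within)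
      qed simp
      then have "integral {0..1} (\<lambda>t. g i (\<gamma> t) * x i) = f (\<gamma> 1) - f (\<gamma> 0)"
        by (rule integral_unique)
      moreover have "\<gamma> 1 = y (Suc i)" "\<gamma> 0 = y i"
        by (auto simp: \<gamma>_def y_def w_def less_Suc_eq)
      ultimately show ?thesis by (simp add: F_def \<gamma>_def)
    qed
    have "f (y p) - f (y 0) = (\<Sum>i<p. F i x * x i)"
      using sum_lessThan_telescope[of "\<lambda>i. f (y i)" p] step by simp
    moreover have "y p = x" "y 0 = (\<lambda>i. 0)"
      using x by (auto simp: y_def cube_def)
    ultimately show ?thesis by simp
  qed
  ultimately show ?thesis using that by blast
qed

section \<open>Formal power series\<close>

lemma carrier_series_algebra:
  "f \<in> carrier (series_algebra n p q d U) \<longleftrightarrow>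
     (\<forall>\<mu>. smooth_fun p U (f \<mu>)) \<and> (\<forall>\<mu> x. x \<notin> U \<longrightarrow> f \<mu> x = 0) \<and>
     (\<forall>\<mu> x. \<mu> \<notin> multiindices n q d \<longrightarrow> f \<mu> x = 0)"
  by (simp add: series_algebra_def Let_def)

lemma series_algebra_simps:
  "mult (series_algebra n p q d U) = series_mult n q d"
  "one (series_algebra n p q d U) = (\<lambda>\<mu> x. if \<mu> = (\<lambda>a. 0) \<and> x \<in> U then 1 else 0)"
  "add (series_algebra n p q d U) = (\<lambda>f g \<mu> x. f \<mu> x + g \<mu> x)"
  "smult (series_algebra n p q d U) = (\<lambda>c f \<mu> x. c * f \<mu> x)"
  by (simp_all add: series_algebra_def Let_def)

lemma zero_multiindex: "(\<lambda>a. 0) \<in> multiindices n q d"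
  by (simp add: multiindices_def)

lemma multiindices_downward:
  assumes "\<rho> \<in> multiindices n q d" "\<And>a. \<mu> a \<le> \<rho> a"
  shows "\<mu> \<in> multiindices n q d"
proof -
  have "\<mu> a = 0" if "a \<ge> q" for a
    using assms(1) assms(2)[of a] that by (simp add: multiindices_def)
  moreover have "\<mu> a \<le> 1" if "a < q" "deg_dot n (d a) (d a) = 1" for a
    using assms(1) assms(2)[of a] that by (fastforce simp: multiindices_def)
  ultimately show ?thesis by (simp add: multiindices_def)
qed

text \<open>A \<open>sum\<close> over an infinite set would be 0 by convention, so the convolution
  in \<open>series_mult\<close> has its intended meaning only through this finiteness. Every
  exponent of a summand is bounded by the total exponent of \<rho>.\<close>

lemma finite_multiindex_splittings:
  assumes "\<rho> \<in> multiindices n q d"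
  shows "finite {(\<mu>, \<nu>). \<mu> \<in> multiindices n q d \<and> \<nu> \<in> multiindices n q d \<and> (\<lambda>a. \<mu> a + \<nu> a) = \<rho>}"
proof (rule finite_subset)
  let ?A = "{\<mu>. \<forall>a. (a \<in> {..<q} \<longrightarrow> \<mu> a \<in> {..\<Sum>a<q. \<rho> a}) \<and> (a \<notin> {..<q} \<longrightarrow> \<mu> a = 0)}"
  have "\<mu> \<in> ?A" if "\<mu> \<in> multiindices n q d" "\<And>a. \<mu> a \<le> \<rho> a" for \<mu>
    using that by (auto simp: multiindices_def intro!: order_trans[OF _ member_le_sum[of _ "{..<q}" \<rho>]])
  then show "{(\<mu>, \<nu>). \<mu> \<in> multiindices n q d \<and> \<nu> \<in> multiindices n q d \<and> (\<lambda>a. \<mu> a + \<nu> a) = \<rho>}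
      \<subseteq> ?A \<times> ?A"
    by (auto simp: le_add1 le_add2)
  show "finite (?A \<times> ?A)"
    by (intro finite_cartesian_product finite_set_of_finite_funs) auto
qed

text \<open>If the right factor is concentrated in one monomial, at most one splitting of \<rho>
  survives. Taking the trivial or a unit multi-index for \<open>\<nu>0\<close> covers multiplication
  by functions of \<open>x\<close> and by a formal variable.\<close>

lemma series_mult_single:
  assumes "\<And>\<nu>. \<nu> \<noteq> \<nu>0 \<Longrightarrow> G \<nu> x = 0" and "\<nu>0 \<in> multiindices n q d" and \<rho>: "\<rho> \<in> multiindices n q d"
  shows "series_mult n q d F G \<rho> x =
     (if \<forall>a. \<nu>0 a \<le> \<rho> a
      then monomial_sign n q d (\<lambda>a. \<rho> a - \<nu>0 a) \<nu>0 * F (\<lambda>a. \<rho> a - \<nu>0 a) x * G \<nu>0 x else 0)"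
proof -
  let ?P = "{(\<mu>, \<nu>). \<mu> \<in> multiindices n q d \<and> \<nu> \<in> multiindices n q d \<and> (\<lambda>a. \<mu> a + \<nu> a) = \<rho>}"
  let ?t = "\<lambda>(\<mu>, \<nu>). monomial_sign n q d \<mu> \<nu> * F \<mu> x * G \<nu> x"
  have eq: "series_mult n q d F G \<rho> x = sum ?t ?P"
    using \<rho> by (simp add: series_mult_def)
  show ?thesis
  proof (cases "\<forall>a. \<nu>0 a \<le> \<rho> a")
    case True
    let ?\<mu> = "\<lambda>a. \<rho> a - \<nu>0 a"
    have "?\<mu> \<in> multiindices n q d" using \<rho> by (rule multiindices_downward) simp
    then have "(?\<mu>, \<nu>0) \<in> ?P" using True assms(2) by auto
    moreover have "?t z = 0" if "z \<in> ?P - {(?\<mu>, \<nu>0)}" for z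
    proof -
      obtain \<mu> \<nu> where z: "z = (\<mu>, \<nu>)" by fastforce
      have "\<nu> \<noteq> \<nu>0" using that by (auto simp: z)
      then show ?thesis using assms(1) by (simp add: z)
    qed
    ultimately have "sum ?t ?P = sum ?t {(?\<mu>, \<nu>0)}"
      using finite_multiindex_splittings[OF \<rho>] by (intro sum.mono_neutral_right) auto
    then show ?thesis using True by (simp add: eq)
  next
    case False
    have "?t z = 0" if "z \<in> ?P" for z
    proof -
      obtain \<mu> \<nu> where z: "z = (\<mu>, \<nu>)" by fastforce
      have "\<nu> \<noteq> \<nu>0" using that False by (auto simp: z)
      then show ?thesis using assms(1) by (simp add: z)
    qed
    then have "sum ?t ?P = 0" by (rule sum.neutral[rule_format])
    then show ?thesis unfolding eq by (simp only: if_not_P[OF False])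
  qed
qed

text \<open>The zero multi-index splits only as a sum of zeros. This is what makes the evaluation of
  germs at the point multiplicative.\<close>

lemma series_mult_constant_coefficient:
  "series_mult n q d F G (\<lambda>a. 0) x = F (\<lambda>a. 0) x * G (\<lambda>a. 0) x"
proof -
  have "{(\<mu>, \<nu>). \<mu> \<in> multiindices n q d \<and> \<nu> \<in> multiindices n q d \<and> (\<lambda>a. \<mu> a + \<nu> a) = (\<lambda>a. 0)}
      = {(\<lambda>a. 0, \<lambda>a. 0)}"
    using zero_multiindex by (auto simp: fun_eq_iff)
  then show ?thesis
    by (simp add: series_mult_def zero_multiindex monomial_sign_def)
qed

section \<open>Coordinates as series and multiplication by them\<close>

definition base_series :: "point set \<Rightarrow> (point \<Rightarrow> real) \<Rightarrow> series" where
  "base_series U f = (\<lambda>\<mu> x. if \<mu> = (\<lambda>a. 0) \<and> x \<in> U then f x else 0)"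

definition formal_variable :: "point set \<Rightarrow> nat \<Rightarrow> series" where
  "formal_variable U a = (\<lambda>\<mu> x. if \<mu> = (\<lambda>b. if b = a then 1 else 0) \<and> x \<in> U then 1 else 0)"

lemma unit_multiindex: "a < q \<Longrightarrow> (\<lambda>b. if b = a then 1 else 0) \<in> multiindices n q d"
  by (auto simp: multiindices_def)

lemma series_mult_base_series:
  assumes "F \<in> carrier (series_algebra n p q d U)"
  shows "series_mult n q d F (base_series U f) = (\<lambda>\<rho> x. F \<rho> x * f x)"
proof (intro ext)
  fix \<rho> x
  show "series_mult n q d F (base_series U f) \<rho> x = F \<rho> x * f x"
  proof (cases "\<rho> \<in> multiindices n q d")
    case True
    have "monomial_sign n q d \<rho> (\<lambda>a. 0) = 1" by (simp add: monomial_sign_def)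
    then show ?thesis
      using series_mult_single[OF _ zero_multiindex True, of "base_series U f" x F] assms
      by (auto simp: base_series_def carrier_series_algebra)
  next
    case False
    then show ?thesis using assms by (simp add: series_mult_def carrier_series_algebra)
  qed
qed

text \<open>The sign and the case distinction are collected in a factor independent of
  \<open>x\<close>, so that smoothness and polynomiality of the product's coefficients reduce to
  scaling by a constant. When \<open>\<rho> a = 0\<close> the truncated subtraction returns \<rho>
  itself, but the factor is then 0.\<close>

lemma series_mult_formal_variable:
  assumes "F \<in> carrier (series_algebra n p q d U)" "a < q"
  shows "series_mult n q d F (formal_variable U a) \<rho> =
     (\<lambda>x. (if \<rho> \<in> multiindices n q d \<and> \<rho> a \<noteq> 0
           then monomial_sign n q d (\<rho>(a := \<rho> a - 1)) (\<lambda>b. if b = a then 1 else 0) else 0) *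
          F (\<rho>(a := \<rho> a - 1)) x)"
proof
  fix x
  let ?e = "\<lambda>b. if b = a then 1 else 0 :: nat"
  show "series_mult n q d F (formal_variable U a) \<rho> x =
     (if \<rho> \<in> multiindices n q d \<and> \<rho> a \<noteq> 0
      then monomial_sign n q d (\<rho>(a := \<rho> a - 1)) ?e else 0) * F (\<rho>(a := \<rho> a - 1)) x"
  proof (cases "\<rho> \<in> multiindices n q d")
    case True
    have "(\<lambda>b. \<rho> b - ?e b) = \<rho>(a := \<rho> a - 1)" by auto
    moreover have "(\<forall>b. ?e b \<le> \<rho> b) \<longleftrightarrow> \<rho> a \<noteq> 0" by (simp add: Suc_le_eq)
    moreover have "formal_variable U a \<nu> x = 0" if "\<nu> \<noteq> ?e" for \<nu>
      using that by (simp add: formal_variable_def)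
    ultimately have "series_mult n q d F (formal_variable U a) \<rho> x =
       (if \<rho> a \<noteq> 0 then monomial_sign n q d (\<rho>(a := \<rho> a - 1)) ?e * F (\<rho>(a := \<rho> a - 1)) x
          * formal_variable U a ?e x else 0)"
      using series_mult_single[OF _ unit_multiindex[OF assms(2)] True, of "formal_variable U a" x F] by simp
    moreover have "F \<mu> x * formal_variable U a ?e x = F \<mu> x" for \<mu>
      using assms(1) by (simp add: formal_variable_def carrier_series_algebra)
    ultimately show ?thesis using True by (simp add: mult.assoc)
  qed (simp add: series_mult_def)
qed

lemma base_series_in_carrier:
  assumes "openin (Euclidean_space p) U" "smooth_fun p U f"
  shows "base_series U f \<in> carrier (series_algebra n p q d U)"
proof -
  have "smooth_fun p U (base_series U f \<mu>)" for \<mu>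
  proof (cases "\<mu> = (\<lambda>a. 0)")
    case True
    show ?thesis by (rule smooth_fun_cong[OF assms(1) _ assms(2)]) (simp add: True base_series_def)
  next
    case False
    then show ?thesis by (simp add: base_series_def smooth_fun_const)
  qed
  then show ?thesis using zero_multiindex by (auto simp: carrier_series_algebra base_series_def)
qed

lemma formal_variable_in_carrier:
  assumes "openin (Euclidean_space p) U" "a < q"
  shows "formal_variable U a \<in> carrier (series_algebra n p q d U)"
proof -
  have "smooth_fun p U (formal_variable U a \<mu>)" for \<mu>
  proof (cases "\<mu> = (\<lambda>b. if b = a then 1 else 0)")
    case True
    show ?thesis
      by (rule smooth_fun_cong[OF assms(1) _ smooth_fun_const[of _ _ 1]]) (simp add: True formal_variable_def)
  next
    case False
    then show ?thesis by (simp add: formal_variable_def smooth_fun_const)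
  qed
  then show ?thesis
    using unit_multiindex[OF assms(2)] by (auto simp: carrier_series_algebra formal_variable_def)
qed

lemma carrier_series_add:
  assumes "F \<in> carrier (series_algebra n p q d U)" "G \<in> carrier (series_algebra n p q d U)"
  shows "(\<lambda>\<mu> x. F \<mu> x + G \<mu> x) \<in> carrier (series_algebra n p q d U)"
  using assms by (simp add: carrier_series_algebra smooth_fun_add)

lemma carrier_series_mult_coordinate:
  assumes "F \<in> carrier (series_algebra n p q d U)"
  shows "series_mult n q d F (base_series U (\<lambda>x. x i)) \<in> carrier (series_algebra n p q d U)"
  unfolding series_mult_base_series[OF assms]
  using assms by (simp add: carrier_series_algebra smooth_fun_mult smooth_fun_coord)

lemma carrier_series_mult_formal_variable:
  assumes "F \<in> carrier (series_algebra n p q d U)" "a < q"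
  shows "series_mult n q d F (formal_variable U a) \<in> carrier (series_algebra n p q d U)"
  unfolding carrier_series_algebra series_mult_formal_variable[OF assms]
  using assms(1) by (simp add: carrier_series_algebra smooth_fun_mult smooth_fun_const)

section \<open>Series with polynomial coefficients\<close>

lemma polynomial_on_const: "polynomial_on p U (\<lambda>x. c)"
  unfolding polynomial_on_def
  by (intro exI[of _ "{\<lambda>a. 0}"] exI[of _ "\<lambda>_. c"]) simp

lemma polynomial_on_cong:
  "(\<And>x. x \<in> U \<Longrightarrow> f x = g x) \<Longrightarrow> polynomial_on p U f \<Longrightarrow> polynomial_on p U g"
  unfolding polynomial_on_def by simp

lemma polynomial_on_add:
  assumes "polynomial_on p U f" "polynomial_on p U g"
  shows "polynomial_on p U (\<lambda>x. f x + g x)"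
proof -
  obtain S c S' c' where f: "finite S" "\<And>x. x \<in> U \<Longrightarrow> f x = (\<Sum>\<alpha>\<in>S. c \<alpha> * (\<Prod>i<p. x i ^ \<alpha> i))"
    and g: "finite S'" "\<And>x. x \<in> U \<Longrightarrow> g x = (\<Sum>\<alpha>\<in>S'. c' \<alpha> * (\<Prod>i<p. x i ^ \<alpha> i))"
    using assms unfolding polynomial_on_def by blast
  let ?c = "\<lambda>\<alpha>. (if \<alpha> \<in> S then c \<alpha> else 0) + (if \<alpha> \<in> S' then c' \<alpha> else 0)"
  have "f x + g x = (\<Sum>\<alpha>\<in>S \<union> S'. ?c \<alpha> * (\<Prod>i<p. x i ^ \<alpha> i))" if "x \<in> U" for x
  proof -
    have "f x = (\<Sum>\<alpha>\<in>S \<union> S'. (if \<alpha> \<in> S then c \<alpha> else 0) * (\<Prod>i<p. x i ^ \<alpha> i))"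
      unfolding f(2)[OF that] by (rule sum.mono_neutral_cong_left) (use f(1) g(1) in auto)
    moreover have "g x = (\<Sum>\<alpha>\<in>S \<union> S'. (if \<alpha> \<in> S' then c' \<alpha> else 0) * (\<Prod>i<p. x i ^ \<alpha> i))"
      unfolding g(2)[OF that] by (rule sum.mono_neutral_cong_left) (use f(1) g(1) in auto)
    ultimately show ?thesis by (simp add: sum.distrib distrib_right)
  qed
  then show ?thesis using f(1) g(1) unfolding polynomial_on_def
    by (intro exI[of _ "S \<union> S'"] exI[of _ ?c]) auto
qed

lemma polynomial_on_cmult:
  assumes "polynomial_on p U f"
  shows "polynomial_on p U (\<lambda>x. k * f x)"
proof -
  obtain S c where f: "finite S" "\<And>x. x \<in> U \<Longrightarrow> f x = (\<Sum>\<alpha>\<in>S. c \<alpha> * (\<Prod>i<p. x i ^ \<alpha> i))"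
    using assms unfolding polynomial_on_def by blast
  then show ?thesis unfolding polynomial_on_def
    by (intro exI[of _ S] exI[of _ "\<lambda>\<alpha>. k * c \<alpha>"]) (simp add: sum_distrib_left mult.assoc)
qed

lemma polynomial_on_mult_coordinate:
  assumes "polynomial_on p U f" "i < p"
  shows "polynomial_on p U (\<lambda>x. f x * x i)"
proof -
  obtain S c where f: "finite S" "\<And>x. x \<in> U \<Longrightarrow> f x = (\<Sum>\<alpha>\<in>S. c \<alpha> * (\<Prod>i<p. x i ^ \<alpha> i))"
    using assms unfolding polynomial_on_def by blast
  \<comment> \<open>Multiplication by \<open>x i\<close> raises the \<open>i\<close>-th exponent.
    The shift is injective, with the decrement as left inverse, so coefficients are carried along
    without collisions.\<close>
  let ?s = "\<lambda>\<alpha> :: multiindex. \<alpha>(i := Suc (\<alpha> i))"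
  have inj: "inj_on ?s S"
    by (rule inj_on_inverseI[where g = "\<lambda>\<beta>. \<beta>(i := \<beta> i - 1)"]) simp
  have monom: "(\<Prod>j<p. x j ^ (?s \<alpha>) j) = (\<Prod>j<p. x j ^ \<alpha> j) * x i" for x :: point and \<alpha>
  proof -
    have "(\<Prod>j<p. x j ^ (?s \<alpha>) j) = (\<Prod>j<p. x j ^ \<alpha> j * (if j = i then x i else 1))"
      by (intro prod.cong) (auto simp: mult.commute)
    then show ?thesis using assms(2) by (simp add: prod.distrib prod.delta)
  qed
  have "f x * x i = (\<Sum>\<beta>\<in>?s ` S. c (\<beta>(i := \<beta> i - 1)) * (\<Prod>j<p. x j ^ \<beta> j))" if "x \<in> U" for x
    unfolding sum.reindex[OF inj] f(2)[OF that] o_def monom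
    by (simp add: sum_distrib_right mult.assoc)
  then show ?thesis unfolding polynomial_on_def using f(1)
    by (intro exI[of _ "?s ` S"] exI[of _ "\<lambda>\<beta>. c (\<beta>(i := \<beta> i - 1))"]) simp
qed

lemma polynomial_sections_iff:
  "P \<in> polynomial_sections n p q d U \<longleftrightarrow>
     P \<in> carrier (series_algebra n p q d U) \<and> (\<forall>\<mu>. polynomial_on p U (P \<mu>))"
  by (simp add: polynomial_sections_def superdomain_def)

lemma polynomial_sections_const:
  assumes "openin (Euclidean_space p) U"
  shows "base_series U (\<lambda>x. c) \<in> polynomial_sections n p q d U"
proof -
  have "polynomial_on p U (base_series U (\<lambda>x. c) \<mu>)" for \<mu>
    by (rule polynomial_on_cong[OF _ polynomial_on_const[of p U "if \<mu> = (\<lambda>a. 0) then c else 0"]])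
       (simp add: base_series_def)
  then show ?thesis
    using base_series_in_carrier[OF assms smooth_fun_const] by (simp add: polynomial_sections_iff)
qed

lemma polynomial_sections_add:
  assumes "P \<in> polynomial_sections n p q d U" "P' \<in> polynomial_sections n p q d U"
  shows "(\<lambda>\<mu> x. P \<mu> x + P' \<mu> x) \<in> polynomial_sections n p q d U"
  using assms by (simp add: polynomial_sections_iff carrier_series_add polynomial_on_add)

lemma polynomial_sections_mult_coordinate:
  assumes "P \<in> polynomial_sections n p q d U" "i < p"
  shows "series_mult n q d P (base_series U (\<lambda>x. x i)) \<in> polynomial_sections n p q d U"
proof -
  have P: "P \<in> carrier (series_algebra n p q d U)" using assms by (simp add: polynomial_sections_iff)
  show ?thesis
    using carrier_series_mult_coordinate[OF P, of i] assms
    by (simp add: polynomial_sections_iff series_mult_base_series[OF P] polynomial_on_mult_coordinate)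
qed

lemma polynomial_sections_mult_formal_variable:
  assumes "P \<in> polynomial_sections n p q d U" "a < q"
  shows "series_mult n q d P (formal_variable U a) \<in> polynomial_sections n p q d U"
proof -
  have P: "P \<in> carrier (series_algebra n p q d U)" using assms by (simp add: polynomial_sections_iff)
  have "polynomial_on p U (series_mult n q d P (formal_variable U a) \<mu>)" for \<mu>
    unfolding series_mult_formal_variable[OF P assms(2)]
    using assms by (intro polynomial_on_cmult) (simp add: polynomial_sections_iff)
  then show ?thesis
    using carrier_series_mult_formal_variable[OF P assms(2)] by (simp add: polynomial_sections_iff)
qed

text \<open>Hadamard's lemma takes care of the coefficient of the trivial monomial. From every other
  monomial its last variable is split off to the right, which produces no sign.\<close>

lemma hadamard_series:
  assumes F: "F \<in> carrier (series_algebra n p q d (cube p r))" and r: "r > 0"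
  obtains c D G where
    "\<And>i. i < p \<Longrightarrow> D i \<in> carrier (series_algebra n p q d (cube p r))"
    "\<And>a. G a \<in> carrier (series_algebra n p q d (cube p r))"
    "F = (\<lambda>\<mu> x. base_series (cube p r) (\<lambda>x. c) \<mu> x +
            ((\<Sum>i<p. series_mult n q d (D i) (base_series (cube p r) (\<lambda>x. x i)) \<mu> x) +
             (\<Sum>a<q. series_mult n q d (G a) (formal_variable (cube p r) a) \<mu> x)))"
proof -
  let ?B = "cube p r" and ?M = "multiindices n q d"
  let ?S = "carrier (series_algebra n p q d ?B)"
  have smooth: "smooth_fun p ?B (F \<mu>)" for \<mu>
    using F by (simp add: carrier_series_algebra)
  have off: "F \<mu> x = 0" if "x \<notin> ?B" for \<mu> x
    using F that by (simp add: carrier_series_algebra)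
  have inadm: "F \<mu> x = 0" if "\<mu> \<notin> ?M" for \<mu> x
    using F that by (simp add: carrier_series_algebra)
  obtain f where f: "\<And>i. i < p \<Longrightarrow> smooth_fun p ?B (f i)"
    "\<And>x. x \<in> ?B \<Longrightarrow> F (\<lambda>a. 0) x = F (\<lambda>a. 0) (\<lambda>i. 0) + (\<Sum>i<p. f i x * x i)"
    using hadamard_cube[OF smooth r] by blast
  define D where "D i = base_series ?B (f i)" for i
  \<comment> \<open>\<open>G a\<close> gathers the monomials whose last variable is
    \<open>a\<close>, with one factor of it removed. If raising the exponent leaves the admissible
    multi-indices, for instance at a variable with exponent at most 1, then \<open>F\<close> is 0
    there.\<close>
  define G where "G a = (\<lambda>\<rho> x. if \<rho> \<in> ?M \<and> (\<forall>b>a. \<rho> b = 0) then F (\<rho>(a := Suc (\<rho> a))) x else 0)" for a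
  have D: "D i \<in> ?S" if "i < p" for i
    unfolding D_def by (rule base_series_in_carrier[OF openin_cube f(1)[OF that]])
  have G: "G a \<in> ?S" for a
    unfolding carrier_series_algebra
  proof (intro conjI allI impI)
    show "smooth_fun p ?B (G a \<mu>)" for \<mu>
    proof -
      have "G a \<mu> = (if \<mu> \<in> ?M \<and> (\<forall>b>a. \<mu> b = 0) then F (\<mu>(a := Suc (\<mu> a))) else (\<lambda>x. 0))"
        by (rule ext) (auto simp: G_def)
      then show ?thesis using smooth smooth_fun_const by simp
    qed
  qed (auto simp: G_def off)
  have eq: "F \<mu> x = base_series ?B (\<lambda>x. F (\<lambda>a. 0) (\<lambda>i. 0)) \<mu> x +
      ((\<Sum>i<p. series_mult n q d (D i) (base_series ?B (\<lambda>x. x i)) \<mu> x) +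
       (\<Sum>a<q. series_mult n q d (G a) (formal_variable ?B a) \<mu> x))" for \<mu> x
  proof -
    have Dm: "(\<Sum>i<p. series_mult n q d (D i) (base_series ?B (\<lambda>x. x i)) \<mu> x) =
        (if \<mu> = (\<lambda>a. 0) \<and> x \<in> ?B then \<Sum>i<p. f i x * x i else 0)"
    proof -
      have "(\<Sum>i<p. series_mult n q d (D i) (base_series ?B (\<lambda>x. x i)) \<mu> x) = (\<Sum>i<p. D i \<mu> x * x i)"
        by (rule sum.cong) (simp_all add: series_mult_base_series[OF D])
      then show ?thesis by (auto simp: D_def base_series_def)
    qed
    have Gm: "series_mult n q d (G a) (formal_variable ?B a) \<mu> x =
        (if \<mu> \<in> ?M \<and> \<mu> a \<noteq> 0 \<and> (\<forall>b>a. \<mu> b = 0) then F \<mu> x else 0)" if a: "a < q" for a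
    proof -
      have *: "monomial_sign n q d (\<mu>(a := \<mu> a - 1)) (\<lambda>b. if b = a then 1 else 0) = 1"
        if "\<forall>b>a. \<mu> b = 0"
        using that unfolding monomial_sign_def by (intro prod.neutral ballI) auto
      have "\<mu>(a := \<mu> a - 1) \<in> ?M" if "\<mu> \<in> ?M"
        using that by (rule multiindices_downward) simp
      then show ?thesis
        unfolding series_mult_formal_variable[OF G a] using * by (auto simp: G_def)
    qed
    show ?thesis
    proof (cases "\<mu> = (\<lambda>a. 0)")
      case True
      then have "(\<Sum>a<q. series_mult n q d (G a) (formal_variable ?B a) \<mu> x) = 0"
        using Gm by simp
      then show ?thesis using True f(2)[of x] off[of x] unfolding Dm by (auto simp: base_series_def)
    next
      case False
      have "(\<Sum>a<q. series_mult n q d (G a) (formal_variable ?B a) \<mu> x) = F \<mu> x"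
      proof (cases "\<mu> \<in> ?M")
        case True
        \<comment> \<open>The last variable occurring in \<mu>. Only the product with this variable
          contributes to the coefficient of \<mu>, so no monomial is counted twice.\<close>
        define l where "l = Max {a. \<mu> a \<noteq> 0}"
        have supp: "{a. \<mu> a \<noteq> 0} \<subseteq> {..<q}"
        proof
          fix a assume "a \<in> {a. \<mu> a \<noteq> 0}"
          moreover have "\<mu> a = 0" if "q \<le> a" using True that by (simp add: multiindices_def)
          ultimately show "a \<in> {..<q}" by (cases "q \<le> a") auto
        qed
        then have fin: "finite {a. \<mu> a \<noteq> 0}" using finite_subset by blast
        have "{a. \<mu> a \<noteq> 0} \<noteq> {}" using False by auto
        from Max_in[OF fin this] have l: "\<mu> l \<noteq> 0" by (simp add: l_def)
        then have lq: "l < q" using supp by auto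
        have last: "\<mu> a \<noteq> 0 \<and> (\<forall>b>a. \<mu> b = 0) \<longleftrightarrow> a = l" for a
        proof -
          have "a \<le> l" if "\<mu> a \<noteq> 0" for a using Max_ge[OF fin, of a] that by (simp add: l_def)
          then show ?thesis using l by (metis linorder_neqE_nat not_le)
        qed
        have "(\<Sum>a<q. series_mult n q d (G a) (formal_variable ?B a) \<mu> x) = (\<Sum>a<q. if a = l then F \<mu> x else 0)"
          using True last by (intro sum.cong refl) (simp add: Gm)
        then show ?thesis using lq by simp
      next
        case False
        then show ?thesis using inadm by (simp add: Gm)
      qed
      then show ?thesis using False unfolding Dm by (simp add: base_series_def)
    qed
  qed
  show ?thesis
  proof (rule that)
    show "D i \<in> ?S" if "i < p" for i using that by (rule D)
    show "G a \<in> ?S" for a by (rule G)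
    show "F = (\<lambda>\<mu> x. base_series ?B (\<lambda>x. F (\<lambda>a. 0) (\<lambda>i. 0)) \<mu> x +
      ((\<Sum>i<p. series_mult n q d (D i) (base_series ?B (\<lambda>x. x i)) \<mu> x) +
       (\<Sum>a<q. series_mult n q d (G a) (formal_variable ?B a) \<mu> x)))"
      by (intro ext) (rule eq)
  qed
qed

section \<open>Stalks\<close>

locale presheaf_point =
  fixes n :: nat and X :: "('m, 'a) graded_space" and m :: 'm
  assumes presheaf: "algebra_presheaf n X" and point: "m \<in> topspace (base X)"
begin

abbreviation nbhd :: "'m set \<Rightarrow> bool" where
  "nbhd N \<equiv> openin (base X) N \<and> m \<in> N"

lemma nbhd_topspace: "nbhd (topspace (base X))"
  using point by auto

lemma sections_algebra: "openin (base X) U \<Longrightarrow> Z2n_comm_algebra n (sections X U)"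
  using presheaf by (simp add: algebra_presheaf_def)

lemma sections_ring: "openin (base X) U \<Longrightarrow> ring (sections X U)"
  using sections_algebra by (simp add: Z2n_comm_algebra_def)

lemma restr_hom:
  "openin (base X) U \<Longrightarrow> openin (base X) V \<Longrightarrow> V \<subseteq> U \<Longrightarrow>
     restr X U V \<in> ring_hom (sections X U) (sections X V)"
  using presheaf by (simp add: algebra_presheaf_def graded_algebra_hom_def)

lemma restr_closed:
  "openin (base X) U \<Longrightarrow> openin (base X) V \<Longrightarrow> V \<subseteq> U \<Longrightarrow> s \<in> carrier (sections X U) \<Longrightarrow>
     restr X U V s \<in> carrier (sections X V)"
  using restr_hom ring_hom_closed by metis

lemma restr_self: "openin (base X) U \<Longrightarrow> s \<in> carrier (sections X U) \<Longrightarrow> restr X U U s = s"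
  using presheaf by (simp add: algebra_presheaf_def)

lemma restr_restr:
  "openin (base X) U \<Longrightarrow> openin (base X) V \<Longrightarrow> openin (base X) N \<Longrightarrow> N \<subseteq> V \<Longrightarrow> V \<subseteq> U \<Longrightarrow>
     s \<in> carrier (sections X U) \<Longrightarrow> restr X V N (restr X U V s) = restr X U N s"
  using presheaf unfolding algebra_presheaf_def by blast

lemma mem_germ:
  "(V, t) \<in> germ X m U s \<longleftrightarrow> nbhd V \<and> t \<in> carrier (sections X V) \<and>
     (\<exists>N. nbhd N \<and> N \<subseteq> U \<inter> V \<and> restr X U N s = restr X V N t)"
  by (auto simp: germ_def)

lemma germ_refl: "nbhd U \<Longrightarrow> s \<in> carrier (sections X U) \<Longrightarrow> (U, s) \<in> germ X m U s"
  unfolding mem_germ by blast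

text \<open>Transitivity of agreement near \<open>m\<close>: the two neighbourhoods of agreement are
  replaced by their intersection. Together with symmetry it shows in \<open>germ_eqI\<close> that
  germs are equivalence classes.\<close>

lemma germ_subset:
  assumes "nbhd U" "s \<in> carrier (sections X U)" "(V, t) \<in> germ X m U s"
  shows "germ X m V t \<subseteq> germ X m U s"
proof (rule subrelI)
  fix Z z assume "(Z, z) \<in> germ X m V t"
  then obtain N' where N': "nbhd Z" "z \<in> carrier (sections X Z)" "nbhd N'" "N' \<subseteq> V \<inter> Z"
    "restr X V N' t = restr X Z N' z"
    unfolding mem_germ by blast
  obtain N where N: "nbhd V" "t \<in> carrier (sections X V)" "nbhd N" "N \<subseteq> U \<inter> V"
    "restr X U N s = restr X V N t"
    using assms(3) unfolding mem_germ by blast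
  have "restr X U (N \<inter> N') s = restr X N (N \<inter> N') (restr X U N s)"
    using assms N N' by (subst restr_restr) auto
  also have "\<dots> = restr X V (N \<inter> N') t"
    unfolding N(5) using N N' by (subst restr_restr) auto
  also have "\<dots> = restr X N' (N \<inter> N') (restr X V N' t)"
    using N N' by (subst restr_restr) auto
  also have "\<dots> = restr X Z (N \<inter> N') z"
    unfolding N'(5) using N N' by (subst restr_restr) auto
  finally show "(Z, z) \<in> germ X m U s"
    unfolding mem_germ using N N' by (intro conjI exI[of _ "N \<inter> N'"]) auto
qed

lemma germ_eqI:
  assumes "nbhd U" "s \<in> carrier (sections X U)" "(V, t) \<in> germ X m U s"
  shows "germ X m V t = germ X m U s"
proof
  show "germ X m V t \<subseteq> germ X m U s" using germ_subset assms .
  have "(U, s) \<in> germ X m V t"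
    using assms unfolding mem_germ by (metis Int_commute)
  then show "germ X m U s \<subseteq> germ X m V t"
    using assms(3) by (intro germ_subset) (auto simp: mem_germ)
qed

lemma germ_eqD:
  assumes "germ X m U s = germ X m V t" "nbhd U" "s \<in> carrier (sections X U)"
  obtains N where "nbhd N" "N \<subseteq> U" "N \<subseteq> V" "restr X U N s = restr X V N t"
proof -
  have "(U, s) \<in> germ X m V t" using germ_refl[OF assms(2,3)] assms(1) by simp
  then show ?thesis unfolding mem_germ by (metis le_inf_iff that)
qed

lemma germ_restr:
  assumes "nbhd U" "nbhd N" "N \<subseteq> U" "s \<in> carrier (sections X U)"
  shows "germ X m N (restr X U N s) = germ X m U s"
proof (rule germ_eqI)
  show "(N, restr X U N s) \<in> germ X m U s"
    unfolding mem_germ using assms restr_closed[of U N s] restr_self[of N "restr X U N s"]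
    by (intro conjI exI[of _ N]) auto
qed (use assms in auto)

section \<open>The ring structure of a stalk\<close>

lemma carrier_stalkI: "nbhd U \<Longrightarrow> s \<in> carrier (sections X U) \<Longrightarrow> germ X m U s \<in> carrier (stalk X m)"
  by (auto simp: stalk_def)

text \<open>The prescribed neighbourhood \<open>W\<close> will be a chart domain, on which the
  inverse chart can be applied to the representative.\<close>

lemma stalk_rep:
  assumes "a \<in> carrier (stalk X m)" "nbhd W"
  obtains N s where "nbhd N" "N \<subseteq> W" "s \<in> carrier (sections X N)" "a = germ X m N s"
proof -
  obtain U s where U: "nbhd U" "s \<in> carrier (sections X U)" "a = germ X m U s"
    using assms(1) by (auto simp: stalk_def)
  show ?thesis
    by (rule that[of "U \<inter> W" "restr X U (U \<inter> W) s"])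
       (use U assms(2) in \<open>simp_all add: germ_restr restr_closed openin_Int\<close>)
qed

lemma stalk_rep2:
  assumes "a \<in> carrier (stalk X m)" "b \<in> carrier (stalk X m)" "nbhd W"
  obtains N s t where "nbhd N" "N \<subseteq> W" "s \<in> carrier (sections X N)" "t \<in> carrier (sections X N)"
    "a = germ X m N s" "b = germ X m N t"
proof -
  obtain U s where U: "nbhd U" "U \<subseteq> W" "s \<in> carrier (sections X U)" "a = germ X m U s"
    using stalk_rep assms(1,3) by blast
  obtain N t where N: "nbhd N" "N \<subseteq> U" "t \<in> carrier (sections X N)" "b = germ X m N t"
    using stalk_rep assms(2) U(1) by blast
  show ?thesis
    by (rule that[of N "restr X U N s" t]) (use U N in \<open>auto simp: germ_restr restr_closed\<close>)
qed

text \<open>The ring laws involve at most three elements, so common representatives reduce each of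
  them to the same law in one ring of sections.\<close>

lemma stalk_rep3:
  assumes "a \<in> carrier (stalk X m)" "b \<in> carrier (stalk X m)" "c \<in> carrier (stalk X m)"
  obtains N s t u where "nbhd N"
    "s \<in> carrier (sections X N)" "t \<in> carrier (sections X N)" "u \<in> carrier (sections X N)"
    "a = germ X m N s" "b = germ X m N t" "c = germ X m N u"
proof -
  obtain U s t where U: "nbhd U" "s \<in> carrier (sections X U)" "t \<in> carrier (sections X U)"
    "a = germ X m U s" "b = germ X m U t"
    using stalk_rep2[OF assms(1,2) nbhd_topspace] by metis
  obtain N u where N: "nbhd N" "N \<subseteq> U" "u \<in> carrier (sections X N)" "c = germ X m N u"
    using stalk_rep assms(3) U(1) by blast
  show ?thesis
    by (rule that[of N "restr X U N s" "restr X U N t" u])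
       (use U N in \<open>auto simp: germ_restr restr_closed\<close>)
qed

text \<open>The operations of \<open>stalk\<close> are unions over all pairs of representatives.
  Naturality under restriction makes all members of the union equal, so it collapses to the germ
  computed from any one pair. The operation \<open>f\<close> is abstract in order to serve for sums
  and products alike.\<close>

lemma germ_binary_operation:
  assumes closed: "\<And>U s t. openin (base X) U \<Longrightarrow> s \<in> carrier (sections X U) \<Longrightarrow>
      t \<in> carrier (sections X U) \<Longrightarrow> f U s t \<in> carrier (sections X U)"
    and natural: "\<And>U V s t. openin (base X) U \<Longrightarrow> openin (base X) V \<Longrightarrow> V \<subseteq> U \<Longrightarrow>
      s \<in> carrier (sections X U) \<Longrightarrow> t \<in> carrier (sections X U) \<Longrightarrow>
      restr X U V (f U s t) = f V (restr X U V s) (restr X U V t)"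
    and N: "nbhd N" and s: "s \<in> carrier (sections X N)" and t: "t \<in> carrier (sections X N)"
  shows "(\<Union>(U, s)\<in>germ X m N s. \<Union>(V, t)\<in>germ X m N t.
      germ X m (U \<inter> V) (f (U \<inter> V) (restr X U (U \<inter> V) s) (restr X V (U \<inter> V) t))) = germ X m N (f N s t)"
proof -
  have eq: "germ X m (U \<inter> V) (f (U \<inter> V) (restr X U (U \<inter> V) s') (restr X V (U \<inter> V) t')) = germ X m N (f N s t)"
    if U: "(U, s') \<in> germ X m N s" and V: "(V, t') \<in> germ X m N t" for U s' V t'
  proof -
    obtain L where L: "nbhd U" "s' \<in> carrier (sections X U)" "nbhd L" "L \<subseteq> N \<inter> U"
      "restr X N L s = restr X U L s'"
      using U unfolding mem_germ by blast
    obtain M where M: "nbhd V" "t' \<in> carrier (sections X V)" "nbhd M" "M \<subseteq> N \<inter> V"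
      "restr X N M t = restr X V M t'"
      using V unfolding mem_germ by blast
    let ?K = "L \<inter> M" and ?UV = "U \<inter> V"
    have K: "nbhd ?K" "nbhd ?UV" "?K \<subseteq> ?UV" "?K \<subseteq> N" using L M by auto
    have "restr X N ?K s = restr X U ?K s'"
      using restr_restr[of N L ?K s] restr_restr[of U L ?K s'] L K N s by auto
    moreover have "restr X N ?K t = restr X V ?K t'"
      using restr_restr[of N M ?K t] restr_restr[of V M ?K t'] M K N t by auto
    ultimately have eqK: "restr X ?UV ?K (f ?UV (restr X U ?UV s') (restr X V ?UV t')) = restr X N ?K (f N s t)"
      using K L M N s t natural restr_closed by (simp add: restr_restr)
    have "f ?UV (restr X U ?UV s') (restr X V ?UV t') \<in> carrier (sections X ?UV)"
      using K L M restr_closed closed by simp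
    then have "(?UV, f ?UV (restr X U ?UV s') (restr X V ?UV t')) \<in> germ X m N (f N s t)"
      unfolding mem_germ using eqK K by (intro conjI exI[of _ ?K]) auto
    then show ?thesis using germ_eqI closed N s t by blast
  qed
  show ?thesis
  \<comment> \<open>A constant union equals that constant only over a nonempty index set; the given
    representatives ensure this.\<close>
  proof (rule SUP_eq_const, goal_cases)
    case 1
    show ?case using germ_refl[OF N s] by blast
  next
    case Us: (2 z)
    obtain U s' where z: "z = (U, s')" by fastforce
    show ?case unfolding z prod.case
    proof (rule SUP_eq_const, goal_cases)
      case 1
      show ?case using germ_refl[OF N t] by blast
    next
      case Vt: (2 y)
      then show ?case using eq[of U s'] Us z by (cases y) simp
    qed
  qed
qed

lemma germ_mult:
  assumes N: "nbhd N" and "s \<in> carrier (sections X N)" "t \<in> carrier (sections X N)"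
  shows "germ X m N s \<otimes>\<^bsub>stalk X m\<^esub> germ X m N t = germ X m N (s \<otimes>\<^bsub>sections X N\<^esub> t)"
  using germ_binary_operation[of "\<lambda>U. mult (sections X U)", OF _ _ assms]
  by (simp add: stalk_def ring.ring_simprules(5)[OF sections_ring] ring_hom_mult[OF restr_hom])

lemma germ_add:
  assumes N: "nbhd N" and "s \<in> carrier (sections X N)" "t \<in> carrier (sections X N)"
  shows "germ X m N s \<oplus>\<^bsub>stalk X m\<^esub> germ X m N t = germ X m N (s \<oplus>\<^bsub>sections X N\<^esub> t)"
  using germ_binary_operation[of "\<lambda>U. add (sections X U)", OF _ _ assms]
  by (simp add: stalk_def ring.ring_simprules(1)[OF sections_ring] ring_hom_add[OF restr_hom])

lemma germ_one: "nbhd N \<Longrightarrow> germ X m N \<one>\<^bsub>sections X N\<^esub> = \<one>\<^bsub>stalk X m\<^esub>"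
  using germ_restr[OF nbhd_topspace, of N "\<one>\<^bsub>sections X (topspace (base X))\<^esub>"]
    ring_hom_one[OF restr_hom, of "topspace (base X)" N] openin_subset[of "base X" N]
    ring.ring_simprules(6)[OF sections_ring, of "topspace (base X)"]
  by (simp add: stalk_def)

lemma germ_zero: "nbhd N \<Longrightarrow> germ X m N \<zero>\<^bsub>sections X N\<^esub> = \<zero>\<^bsub>stalk X m\<^esub>"
  using germ_restr[OF nbhd_topspace, of N "\<zero>\<^bsub>sections X (topspace (base X))\<^esub>"]
    ring_hom_zero[OF restr_hom, of "topspace (base X)" N] openin_subset[of "base X" N] sections_ring
    ring.ring_simprules(2)[OF sections_ring, of "topspace (base X)"]
  by (simp add: stalk_def)

lemma stalk_ring: "ring (stalk X m)"
proof (rule ringI)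
  let ?R = "stalk X m"
  note ops = germ_add germ_mult ring.ring_simprules(1,5)[OF sections_ring]
  show "abelian_group ?R"
  proof (rule abelian_groupI)
    show "a \<oplus>\<^bsub>?R\<^esub> b \<in> carrier ?R" if "a \<in> carrier ?R" "b \<in> carrier ?R" for a b
      using stalk_rep2[OF that nbhd_topspace]
      by (metis germ_add carrier_stalkI ring.ring_simprules(1) sections_ring)
    show "\<zero>\<^bsub>?R\<^esub> \<in> carrier ?R"
      using germ_zero[OF nbhd_topspace] carrier_stalkI[OF nbhd_topspace]
        ring.ring_simprules(2)[OF sections_ring] nbhd_topspace by metis
    show "a \<oplus>\<^bsub>?R\<^esub> b \<oplus>\<^bsub>?R\<^esub> c = a \<oplus>\<^bsub>?R\<^esub> (b \<oplus>\<^bsub>?R\<^esub> c)"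
      if "a \<in> carrier ?R" "b \<in> carrier ?R" "c \<in> carrier ?R" for a b c
      by (rule stalk_rep3[OF that]) (simp add: ops ring.ring_simprules(7)[OF sections_ring])
    show "a \<oplus>\<^bsub>?R\<^esub> b = b \<oplus>\<^bsub>?R\<^esub> a" if "a \<in> carrier ?R" "b \<in> carrier ?R" for a b
      by (rule stalk_rep2[OF that nbhd_topspace])
         (simp add: ops ring.ring_simprules(10)[OF sections_ring])
    show "\<zero>\<^bsub>?R\<^esub> \<oplus>\<^bsub>?R\<^esub> a = a" if "a \<in> carrier ?R" for a
      by (rule stalk_rep[OF that nbhd_topspace])
         (simp add: ops germ_zero[symmetric] ring.ring_simprules(2,8)[OF sections_ring])
    show "\<exists>b\<in>carrier ?R. b \<oplus>\<^bsub>?R\<^esub> a = \<zero>\<^bsub>?R\<^esub>" if a: "a \<in> carrier ?R" for a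
    proof -
      obtain N s where N: "nbhd N" "s \<in> carrier (sections X N)" "a = germ X m N s"
        using stalk_rep[OF a nbhd_topspace] by metis
      then show ?thesis
        by (intro bexI[of _ "germ X m N (\<ominus>\<^bsub>sections X N\<^esub> s)"])
           (simp_all add: ops germ_zero carrier_stalkI ring.ring_simprules(3,9)[OF sections_ring])
    qed
  qed
  show "monoid ?R"
  proof (rule monoidI)
    show "a \<otimes>\<^bsub>?R\<^esub> b \<in> carrier ?R" if "a \<in> carrier ?R" "b \<in> carrier ?R" for a b
      by (rule stalk_rep2[OF that nbhd_topspace]) (simp add: ops carrier_stalkI)
    show "\<one>\<^bsub>?R\<^esub> \<in> carrier ?R"
      using germ_one[OF nbhd_topspace] carrier_stalkI[OF nbhd_topspace]
        ring.ring_simprules(6)[OF sections_ring] nbhd_topspace by metis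
    show "a \<otimes>\<^bsub>?R\<^esub> b \<otimes>\<^bsub>?R\<^esub> c = a \<otimes>\<^bsub>?R\<^esub> (b \<otimes>\<^bsub>?R\<^esub> c)"
      if "a \<in> carrier ?R" "b \<in> carrier ?R" "c \<in> carrier ?R" for a b c
      by (rule stalk_rep3[OF that]) (simp add: ops ring.ring_simprules(11)[OF sections_ring])
    show "\<one>\<^bsub>?R\<^esub> \<otimes>\<^bsub>?R\<^esub> a = a" if "a \<in> carrier ?R" for a
      by (rule stalk_rep[OF that nbhd_topspace])
         (simp add: ops germ_one[symmetric] ring.ring_simprules(6,12)[OF sections_ring])
    show "a \<otimes>\<^bsub>?R\<^esub> \<one>\<^bsub>?R\<^esub> = a" if "a \<in> carrier ?R" for a
      by (rule stalk_rep[OF that nbhd_topspace])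
         (simp add: ops germ_one[symmetric] ring.ring_simprules(6)[OF sections_ring]
            monoid.r_one[OF ring.is_monoid[OF sections_ring]])
  qed
  show "(a \<oplus>\<^bsub>?R\<^esub> b) \<otimes>\<^bsub>?R\<^esub> c = a \<otimes>\<^bsub>?R\<^esub> c \<oplus>\<^bsub>?R\<^esub> b \<otimes>\<^bsub>?R\<^esub> c"
    if "a \<in> carrier ?R" "b \<in> carrier ?R" "c \<in> carrier ?R" for a b c
    by (rule stalk_rep3[OF that]) (simp add: ops ring.ring_simprules(13)[OF sections_ring])
  show "c \<otimes>\<^bsub>?R\<^esub> (a \<oplus>\<^bsub>?R\<^esub> b) = c \<otimes>\<^bsub>?R\<^esub> a \<oplus>\<^bsub>?R\<^esub> c \<otimes>\<^bsub>?R\<^esub> b"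
    if "a \<in> carrier ?R" "b \<in> carrier ?R" "c \<in> carrier ?R" for a b c
    by (rule stalk_rep3[OF that]) (simp add: ops ring.ring_simprules(23)[OF sections_ring])
qed

lemma germ_ring_hom:
  assumes "nbhd N"
  shows "germ X m N \<in> ring_hom (sections X N) (stalk X m)"
  using assms by (intro ring_hom_memI) (auto simp: germ_add germ_mult germ_one carrier_stalkI)

end

section \<open>Charts\<close>

lemma ring_hom_finsum:
  assumes "ring R" "ring S" "h \<in> ring_hom R S" "f \<in> A \<rightarrow> carrier R"
  shows "h (\<Oplus>\<^bsub>R\<^esub>i\<in>A. f i) = (\<Oplus>\<^bsub>S\<^esub>i\<in>A. h (f i))"
proof -
  interpret ring_hom_ring R S h using assms(1-3) by (rule ring_hom_ringI2)
  show ?thesis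
    using assms(4) by (induction A rule: infinite_finite_induct) (auto simp: Pi_def)
qed

lemma finite_Z2n: "finite (Z2n n)"
proof -
  have "Z2n n = {i. \<forall>k. (k \<in> {..<n} \<longrightarrow> i k \<in> UNIV) \<and> (k \<notin> {..<n} \<longrightarrow> i k = 0)}"
    by (auto simp: Z2n_def)
  moreover have "finite (UNIV :: bit set)"
    by (rule finite_subset[of _ "{0, 1}"]) auto
  ultimately show ?thesis using finite_set_of_finite_funs[of "{..<n}" "UNIV :: bit set" 0] by simp
qed

lemma deg_zero_in_Z2n: "deg_zero \<in> Z2n n"
  by (simp add: Z2n_def deg_zero_def)

lemma real_ring_simps:
  "carrier real_ring = UNIV" "mult real_ring = (*)" "one real_ring = 1" "zero real_ring = 0" "add real_ring = (+)"
  by (simp_all add: real_ring_def)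

lemma ideal_power_0: "ideal_power A I 0 = carrier A"
  by (simp add: ideal_power_def nat_pow_def ideals_set_def)

text \<open>The new factor stands on the right. Since the stalk need not be commutative, this fixes
  the side on which coordinates are split off from a series.\<close>

lemma ideal_power_Suc: "ideal_power A I (Suc k) = ideal_prod A (ideal_power A I k) I"
  by (simp add: ideal_power_def nat_pow_def ideals_set_def)

lemma ideal_power_is_ideal:
  assumes "ring A" "ideal I A"
  shows "ideal (ideal_power A I k) A"
proof (induction k)
  case 0
  then show ?case using ring.oneideal[OF assms(1)] by (simp add: ideal_power_0)
next
  case (Suc k)
  then show ?case using ring.ideal_prod_is_ideal[OF assms(1) _ assms(2)] by (simp add: ideal_power_Suc)
qed

text \<open>The inverse morphism \<open>(\<psi>, g)\<close> is a parameter because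
  \<open>space_isomorphism\<close> only asserts its existence, while the residue map is defined
  through \<open>g\<close>.\<close>

locale centered_chart = presheaf_point n X m
  for n :: nat and X :: "('m, 'a) graded_space" and m :: 'm +
  fixes p q :: nat and d :: "nat \<Rightarrow> degree" and W :: "'m set" and V :: "point set"
    and \<phi> :: "'m \<Rightarrow> point" and h :: "point set \<Rightarrow> series \<Rightarrow> 'a"
    and \<psi> :: "point \<Rightarrow> 'm" and g :: "'m set \<Rightarrow> 'a \<Rightarrow> series"
  assumes W: "openin (base X) W" "m \<in> W"
    and V: "openin (Euclidean_space p) V"
    and centered: "\<phi> m = (\<lambda>i. 0)"
    and h_morphism: "space_morphism n (open_subspace X W) (superdomain n p q d V) \<phi> h"
    and g_morphism: "space_morphism n (superdomain n p q d V) (open_subspace X W) \<psi> g"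
    and \<psi>_\<phi>: "\<And>x. x \<in> W \<Longrightarrow> \<psi> (\<phi> x) = x"
    and \<phi>_\<psi>: "\<And>y. y \<in> V \<Longrightarrow> \<phi> (\<psi> y) = y"
    and g_h: "\<And>B F. openin (base (superdomain n p q d V)) B \<Longrightarrow>
      F \<in> carrier (sections (superdomain n p q d V) B) \<Longrightarrow>
      g (preim (open_subspace X W) \<phi> B) (h B F) = F"
    and h_g: "\<And>N s. openin (base (open_subspace X W)) N \<Longrightarrow>
      s \<in> carrier (sections (open_subspace X W) N) \<Longrightarrow>
      h (preim (superdomain n p q d V) \<psi> N) (g N s) = s"
begin

abbreviation R where "R \<equiv> stalk X m"
abbreviation S where "S \<equiv> series_algebra n p q d"

definition pull :: "point set \<Rightarrow> 'm set" where "pull B = {x \<in> W. \<phi> x \<in> B}"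
definition push :: "'m set \<Rightarrow> point set" where "push N = {y \<in> V. \<psi> y \<in> N}"

lemma base_superdomain: "openin (base (superdomain n p q d V)) B \<longleftrightarrow> openin (Euclidean_space p) B \<and> B \<subseteq> V"
  using openin_open_subtopology[OF V] by (simp add: superdomain_def)

lemma base_open_subspace: "openin (base (open_subspace X W)) N \<longleftrightarrow> openin (base X) N \<and> N \<subseteq> W"
  using openin_open_subtopology[OF W(1)] by (simp add: open_subspace_def)

lemma space_simps:
  "sections (superdomain n p q d V) = S"
  "restr (superdomain n p q d V) = (\<lambda>V W f \<mu> x. if x \<in> W then f \<mu> x else 0)"
  "sections (open_subspace X W) = sections X" "restr (open_subspace X W) = restr X"
  by (simp_all add: superdomain_def open_subspace_def)

lemma topspace_superdomain: "topspace (base (superdomain n p q d V)) = V"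
  using openin_subset[OF V] by (auto simp: superdomain_def)

lemma topspace_open_subspace: "topspace (base (open_subspace X W)) = W"
  using openin_subset[OF W(1)] by (auto simp: open_subspace_def)

lemma preim_\<phi>: "preim (open_subspace X W) \<phi> = pull"
  by (simp add: fun_eq_iff preim_def pull_def topspace_open_subspace)

lemma preim_\<psi>: "preim (superdomain n p q d V) \<psi> = push"
  by (simp add: fun_eq_iff preim_def push_def topspace_superdomain)

lemmas chart_simps = base_superdomain base_open_subspace space_simps topspace_superdomain
  topspace_open_subspace preim_\<phi> preim_\<psi>

lemma \<phi>_in_V: "x \<in> W \<Longrightarrow> \<phi> x \<in> V"
  using h_morphism continuous_map_image_subset_topspace
  unfolding space_morphism_def by (fastforce simp: chart_simps)

lemma \<psi>_in_W: "y \<in> V \<Longrightarrow> \<psi> y \<in> W"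
  using g_morphism continuous_map_image_subset_topspace
  unfolding space_morphism_def by (fastforce simp: chart_simps)

lemma origin_in_V: "(\<lambda>i. 0) \<in> V"
  using \<phi>_in_V[OF W(2)] centered by simp

lemma \<psi>_origin: "\<psi> (\<lambda>i. 0) = m"
  using \<psi>_\<phi>[OF W(2)] centered by simp

lemma pull_push: "N \<subseteq> W \<Longrightarrow> pull (push N) = N"
  using \<phi>_in_V \<psi>_\<phi> by (auto simp: pull_def push_def)

lemma push_pull: "B \<subseteq> V \<Longrightarrow> push (pull B) = B"
  using \<psi>_in_W \<phi>_\<psi> by (auto simp: pull_def push_def)

lemma pull_V: "pull V = W"
  using \<phi>_in_V by (auto simp: pull_def)

lemma open_pull:
  assumes "openin (Euclidean_space p) B" "B \<subseteq> V"
  shows "openin (base X) (pull B)" "pull B \<subseteq> W"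
proof -
  have "continuous_map (base (open_subspace X W)) (base (superdomain n p q d V)) \<phi>"
    using h_morphism unfolding space_morphism_def by blast
  from openin_continuous_map_preimage[OF this, of B] assms
  show "openin (base X) (pull B)" "pull B \<subseteq> W" by (simp_all add: chart_simps pull_def)
qed

lemma nbhd_pull:
  "openin (Euclidean_space p) B \<Longrightarrow> B \<subseteq> V \<Longrightarrow> (\<lambda>i. 0) \<in> B \<Longrightarrow> nbhd (pull B)"
  using open_pull(1)[of B] W(2) centered by (simp add: pull_def)

lemma open_push:
  assumes "openin (base X) N" "N \<subseteq> W"
  shows "openin (Euclidean_space p) (push N)" "push N \<subseteq> V"
proof -
  have "continuous_map (base (superdomain n p q d V)) (base (open_subspace X W)) \<psi>"
    using g_morphism unfolding space_morphism_def by blast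
  from openin_continuous_map_preimage[OF this, of N] assms
  show "openin (Euclidean_space p) (push N)" "push N \<subseteq> V" by (simp_all add: chart_simps push_def)
qed

lemma origin_in_push: "m \<in> N \<Longrightarrow> (\<lambda>i. 0) \<in> push N"
  using origin_in_V \<psi>_origin by (simp add: push_def)

lemma h_hom:
  "openin (Euclidean_space p) B \<Longrightarrow> B \<subseteq> V \<Longrightarrow> h B \<in> ring_hom (S B) (sections X (pull B))"
  using h_morphism unfolding space_morphism_def graded_algebra_hom_def by (simp add: chart_simps)

lemma g_hom:
  "openin (base X) N \<Longrightarrow> N \<subseteq> W \<Longrightarrow> g N \<in> graded_algebra_hom n (sections X N) (S (push N))"
  using g_morphism unfolding space_morphism_def by (simp add: chart_simps)

lemma g_ring_hom:
  "openin (base X) N \<Longrightarrow> N \<subseteq> W \<Longrightarrow> g N \<in> ring_hom (sections X N) (S (push N))"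
  using g_hom unfolding graded_algebra_hom_def by blast

lemma h_restr:
  "openin (Euclidean_space p) B \<Longrightarrow> B \<subseteq> V \<Longrightarrow> openin (Euclidean_space p) C \<Longrightarrow> C \<subseteq> B \<Longrightarrow>
     F \<in> carrier (S B) \<Longrightarrow>
     h C (\<lambda>\<mu> x. if x \<in> C then F \<mu> x else 0) = restr X (pull B) (pull C) (h B F)"
  using h_morphism unfolding space_morphism_def by (auto simp: chart_simps)

lemma g_restr:
  "openin (base X) N \<Longrightarrow> N \<subseteq> W \<Longrightarrow> openin (base X) N' \<Longrightarrow> N' \<subseteq> N \<Longrightarrow> s \<in> carrier (sections X N) \<Longrightarrow>
     g N' (restr X N N' s) = (\<lambda>\<mu> x. if x \<in> push N' then g N s \<mu> x else 0)"
  using g_morphism unfolding space_morphism_def by (auto simp: chart_simps)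

text \<open>The residue map of the stalk: a germ is pulled back along the inverse chart and its
  coefficient of the trivial monomial is evaluated at the origin.\<close>

definition value_at :: "('m set \<times> 'a) set \<Rightarrow> real" where
  "value_at \<gamma> = (SOME c. \<exists>N s. nbhd N \<and> N \<subseteq> W \<and> s \<in> carrier (sections X N) \<and>
     \<gamma> = germ X m N s \<and> c = g N s (\<lambda>a. 0) (\<lambda>i. 0))"

text \<open>Independence of the representative: two representatives agree on some smaller
  \<open>L\<close>, the map \<open>g\<close> commutes with restriction, and restriction keeps the
  value at the origin because the origin lies in \<open>push L\<close>.\<close>

lemma value_at_germ:
  assumes N: "nbhd N" "N \<subseteq> W" and s: "s \<in> carrier (sections X N)"
  shows "value_at (germ X m N s) = g N s (\<lambda>a. 0) (\<lambda>i. 0)"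
  unfolding value_at_def
proof (rule some_equality)
  show "\<exists>N' s'. nbhd N' \<and> N' \<subseteq> W \<and> s' \<in> carrier (sections X N') \<and> germ X m N s = germ X m N' s' \<and>
      g N s (\<lambda>a. 0) (\<lambda>i. 0) = g N' s' (\<lambda>a. 0) (\<lambda>i. 0)"
    using assms by blast
next
  fix c
  assume "\<exists>N' s'. nbhd N' \<and> N' \<subseteq> W \<and> s' \<in> carrier (sections X N') \<and> germ X m N s = germ X m N' s' \<and>
      c = g N' s' (\<lambda>a. 0) (\<lambda>i. 0)"
  then obtain N' s' where N': "nbhd N'" "N' \<subseteq> W" "s' \<in> carrier (sections X N')"
    "germ X m N s = germ X m N' s'" "c = g N' s' (\<lambda>a. 0) (\<lambda>i. 0)" by blast
  obtain L where L: "nbhd L" "L \<subseteq> N" "L \<subseteq> N'" "restr X N L s = restr X N' L s'"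
    using germ_eqD[OF N'(4) N(1) s] .
  have "g N s (\<lambda>a. 0) (\<lambda>i. 0) = g L (restr X N L s) (\<lambda>a. 0) (\<lambda>i. 0)"
    using g_restr[of N L s] N s L origin_in_push[of L] by simp
  also have "\<dots> = g N' s' (\<lambda>a. 0) (\<lambda>i. 0)"
    unfolding L(4) using g_restr[of N' L s'] N' L origin_in_push[of L] by simp
  finally show "c = g N s (\<lambda>a. 0) (\<lambda>i. 0)" using N'(5) by simp
qed

text \<open>The ring laws are read off from the module structure of the sections, whose axioms
  include them for the scalars.\<close>

lemma real_ring_ring: "ring real_ring"
proof -
  have "module real_ring (sections X W)"
    using sections_algebra[OF W(1)] by (simp add: Z2n_comm_algebra_def)
  then show ?thesis using module.axioms(1) cring.axioms(1) by blast
qed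

lemma value_at_hom: "value_at \<in> ring_hom R real_ring"
proof (rule ring_hom_memI)
  show "value_at a \<in> carrier real_ring" for a by (simp add: real_ring_simps)
  show "value_at (a \<otimes>\<^bsub>R\<^esub> b) = value_at a \<otimes>\<^bsub>real_ring\<^esub> value_at b"
    if ab: "a \<in> carrier R" "b \<in> carrier R" for a b
  proof -
    obtain N s t where N: "nbhd N" "N \<subseteq> W" "s \<in> carrier (sections X N)" "t \<in> carrier (sections X N)"
      "a = germ X m N s" "b = germ X m N t"
      using stalk_rep2[OF ab] W by metis
    then show ?thesis
      using ring_hom_mult[OF g_ring_hom[of N], of s t]
      by (simp add: germ_mult value_at_germ ring.ring_simprules(5)[OF sections_ring]
          series_algebra_simps series_mult_constant_coefficient real_ring_simps)
  qed
  show "value_at (a \<oplus>\<^bsub>R\<^esub> b) = value_at a \<oplus>\<^bsub>real_ring\<^esub> value_at b"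
    if ab: "a \<in> carrier R" "b \<in> carrier R" for a b
  proof -
    obtain N s t where N: "nbhd N" "N \<subseteq> W" "s \<in> carrier (sections X N)" "t \<in> carrier (sections X N)"
      "a = germ X m N s" "b = germ X m N t"
      using stalk_rep2[OF ab] W by metis
    then show ?thesis
      using ring_hom_add[OF g_ring_hom[of N], of s t]
      by (simp add: germ_add value_at_germ ring.ring_simprules(1)[OF sections_ring]
          series_algebra_simps real_ring_simps)
  qed
  show "value_at \<one>\<^bsub>R\<^esub> = \<one>\<^bsub>real_ring\<^esub>"
    using ring_hom_one[OF g_ring_hom[of W]] W origin_in_push[of W]
    by (simp add: germ_one[of W, symmetric] value_at_germ ring.ring_simprules(6)[OF sections_ring]
        series_algebra_simps real_ring_simps)
qed

sublocale value_at: ring_hom_ring R real_ring value_at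
  by (rule ring_hom_ringI2[OF stalk_ring real_ring_ring value_at_hom])

definition vanishing :: "('m set \<times> 'a) set set" where
  "vanishing = {a \<in> carrier R. value_at a = 0}"

lemma vanishing_ideal: "ideal vanishing R"
proof -
  have "a_kernel R real_ring value_at = vanishing"
    unfolding a_kernel_def' vanishing_def by (simp only: real_ring_simps)
  then show ?thesis using value_at.kernel_is_ideal by simp
qed

text \<open>The trivial monomial has degree zero and \<open>g\<close> preserves degrees, so the
  series of a section of another degree has no such term.\<close>

lemma value_at_homogeneous:
  assumes N: "nbhd N" "N \<subseteq> W" and i: "i \<in> Z2n n" "i \<noteq> deg_zero" and s: "s \<in> homog (sections X N) i"
    and carr: "s \<in> carrier (sections X N)"
  shows "value_at (germ X m N s) = 0"
proof -
  have "g N s \<in> homog (S (push N)) i"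
    using g_hom[of N] N i(1) s unfolding graded_algebra_hom_def by blast
  moreover have "monomial_degree q d (\<lambda>a. 0) \<noteq> i"
    using i(2) by (auto simp: monomial_degree_def deg_zero_def)
  ultimately have "g N s (\<lambda>a. 0) = (\<lambda>x. 0)"
    by (simp add: series_algebra_def Let_def)
  then show ?thesis using N carr by (simp add: value_at_germ)
qed

text \<open>All components of nonzero degree have residue 0 anyway. The residue of the germ is thus
  that of its degree-zero component, which must vanish as well.\<close>

lemma vanishing_homogeneous: "homogeneous_ideal n R vanishing"
  unfolding homogeneous_ideal_def
proof (intro conjI ballI vanishing_ideal)
  fix a assume a: "a \<in> vanishing"
  obtain N s where N: "nbhd N" "N \<subseteq> W" "s \<in> carrier (sections X N)" "a = germ X m N s"
    using stalk_rep[of a W] a W by (auto simp: vanishing_def)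
  have alg: "Z2n_comm_algebra n (sections X N)" using sections_algebra N(1) by blast
  then obtain c where c: "c \<in> (\<Pi>\<^sub>E i\<in>Z2n n. homog (sections X N) i)"
    "s = (\<Oplus>\<^bsub>sections X N\<^esub>i\<in>Z2n n. c i)"
    using N(3) unfolding Z2n_comm_algebra_def by blast
  have sub: "homog (sections X N) i \<subseteq> carrier (sections X N)" if "i \<in> Z2n n" for i
    using alg that submodule.axioms(1)[of "homog (sections X N) i" real_ring "sections X N"]
      subgroup.subset[of "homog (sections X N) i" "add_monoid (sections X N)"]
    unfolding Z2n_comm_algebra_def by auto
  have carr: "c i \<in> carrier (sections X N)" "c i \<in> homog (sections X N) i" if "i \<in> Z2n n" for i
    using c(1) sub that by auto
  let ?c = "\<lambda>i. germ X m N (c i)"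
  have a_sum: "a = (\<Oplus>\<^bsub>R\<^esub>i\<in>Z2n n. ?c i)"
    unfolding N(4) c(2)
    using N(1) carr by (intro ring_hom_finsum sections_ring stalk_ring germ_ring_hom) auto
  have homog: "?c i \<in> homog R i" "?c i \<in> carrier R" if "i \<in> Z2n n" for i
    using carr[OF that] N(1) carrier_stalkI by (auto simp: stalk_def)
  have nonzero: "value_at (?c i) = 0" if "i \<in> Z2n n" "i \<noteq> deg_zero" for i
    using value_at_homogeneous[OF N(1,2) that] carr[OF that(1)] by blast
  have "value_at a = (\<Oplus>\<^bsub>real_ring\<^esub>i\<in>Z2n n. value_at (?c i))"
    unfolding a_sum using homog(2) by (intro ring_hom_finsum stalk_ring real_ring_ring value_at_hom) auto
  also have "\<dots> = (\<Oplus>\<^bsub>real_ring\<^esub>i\<in>Z2n n. if deg_zero = i then value_at (?c i) else \<zero>\<^bsub>real_ring\<^esub>)"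
    using nonzero by (intro value_at.S.add.finprod_cong') (auto simp: real_ring_simps)
  also have "\<dots> = value_at (?c deg_zero)"
    by (rule value_at.S.finsum_singleton[OF deg_zero_in_Z2n finite_Z2n]) (simp add: real_ring_simps)
  finally have "value_at (?c deg_zero) = 0" using a by (simp add: vanishing_def)
  then have "\<forall>i\<in>Z2n n. ?c i \<in> homog R i \<inter> vanishing"
    using homog nonzero by (auto simp: vanishing_def)
  with a_sum show "\<exists>c. (\<forall>i\<in>Z2n n. c i \<in> homog R i \<inter> vanishing) \<and> a = (\<Oplus>\<^bsub>R\<^esub>i\<in>Z2n n. c i)"
    by (intro exI[of _ ?c] conjI)
qed

text \<open>The domain \<open>B\<close> varies because polynomials are series over \<open>V\<close>,
  while the given function yields a series only over a small cube.\<close>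

definition chart_germ :: "point set \<Rightarrow> series \<Rightarrow> ('m set \<times> 'a) set" where
  "chart_germ B F = germ X m (pull B) (h B F)"

context
  fixes B assumes B: "openin (Euclidean_space p) B" "B \<subseteq> V" "(\<lambda>i. 0) \<in> B"
begin

lemma chart_germ_hom: "chart_germ B \<in> ring_hom (S B) R"
proof -
  have "chart_germ B = germ X m (pull B) \<circ> h B" by (simp add: fun_eq_iff chart_germ_def)
  then show ?thesis
    using ring_hom_trans[OF h_hom[OF B(1,2)] germ_ring_hom[OF nbhd_pull[OF B]]] by simp
qed

lemma chart_germ_closed: "F \<in> carrier (S B) \<Longrightarrow> chart_germ B F \<in> carrier R"
  using ring_hom_closed[OF chart_germ_hom] .

lemma chart_germ_add:
  "F \<in> carrier (S B) \<Longrightarrow> G \<in> carrier (S B) \<Longrightarrow>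
     chart_germ B (\<lambda>\<mu> x. F \<mu> x + G \<mu> x) = chart_germ B F \<oplus>\<^bsub>R\<^esub> chart_germ B G"
  using ring_hom_add[OF chart_germ_hom] by (simp add: series_algebra_simps)

lemma chart_germ_mult:
  "F \<in> carrier (S B) \<Longrightarrow> G \<in> carrier (S B) \<Longrightarrow>
     chart_germ B (series_mult n q d F G) = chart_germ B F \<otimes>\<^bsub>R\<^esub> chart_germ B G"
  using ring_hom_mult[OF chart_germ_hom] by (simp add: series_algebra_simps)

lemma value_at_chart_germ:
  "F \<in> carrier (S B) \<Longrightarrow> value_at (chart_germ B F) = F (\<lambda>a. 0) (\<lambda>i. 0)"
  using nbhd_pull[OF B] open_pull[OF B(1,2)] ring_hom_closed[OF h_hom[OF B(1,2)]] g_h[of B F] B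
  by (simp add: chart_germ_def value_at_germ chart_simps)

text \<open>Restriction in the superdomain is cutting off by 0. As \<open>h\<close> commutes with
  restriction, the cut-off series defines the same germ.\<close>

lemma chart_germ_restr:
  assumes "F \<in> carrier (S V)"
  shows "chart_germ B (\<lambda>\<mu> x. if x \<in> B then F \<mu> x else 0) = chart_germ V F"
proof -
  have "h V F \<in> carrier (sections X W)"
    using ring_hom_closed[OF h_hom[OF V order_refl] assms] by (simp add: pull_V)
  then show ?thesis
    unfolding chart_germ_def h_restr[OF V order_refl B(1,2) assms]
    using germ_restr[OF _ nbhd_pull[OF B] open_pull(2)[OF B(1,2)]] W by (simp add: pull_V)
qed

end

text \<open>If \<open>K\<close> contained some \<open>x\<close> with nonzero residue, a constant
  section \<open>y\<close> with the reciprocal residue would give \<open>1 - x y\<close> residue 0.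
  Then \<open>1 - x y\<close> and \<open>x y\<close> both lie in \<open>K\<close>, hence so does
  1.\<close>

lemma vanishing_maximal: "maximal_homogeneous_ideal n R vanishing"
  unfolding maximal_homogeneous_ideal_def
proof (intro conjI allI impI vanishing_homogeneous)
  have one: "\<one>\<^bsub>R\<^esub> \<in> carrier R" "value_at \<one>\<^bsub>R\<^esub> = 1"
    using value_at.hom_one by (simp_all add: real_ring_simps)
  then show "vanishing \<noteq> carrier R" by (force simp: vanishing_def)
  fix K assume K: "homogeneous_ideal n R K \<and> vanishing \<subseteq> K \<and> K \<noteq> carrier R"
  then interpret K: ideal K R by (simp add: homogeneous_ideal_def)
  have "x \<in> vanishing" if x: "x \<in> K" for x
  proof (rule ccontr)
    assume "x \<notin> vanishing"
    have xR: "x \<in> carrier R" using x by (rule K.Icarr)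
    then have nz: "value_at x \<noteq> 0" using \<open>x \<notin> vanishing\<close> by (simp add: vanishing_def)
    let ?F = "base_series V (\<lambda>x'. 1 / value_at x)"
    have F: "?F \<in> carrier (S V)" by (intro base_series_in_carrier V smooth_fun_const)
    define y where "y = chart_germ V ?F"
    have y: "y \<in> carrier R" "value_at y = 1 / value_at x"
      using chart_germ_closed[OF V order_refl origin_in_V F] value_at_chart_germ[OF V order_refl origin_in_V F]
      by (simp_all add: y_def base_series_def origin_in_V)
    have xy: "x \<otimes>\<^bsub>R\<^esub> y \<in> K" "x \<otimes>\<^bsub>R\<^esub> y \<in> carrier R" using x xR y(1) K.I_r_closed by auto
    have "value_at (x \<otimes>\<^bsub>R\<^esub> y) = \<one>\<^bsub>real_ring\<^esub>"
      using value_at.hom_mult[OF xR y(1)] y(2) nz by (simp add: real_ring_simps)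
    then have "value_at (\<one>\<^bsub>R\<^esub> \<ominus>\<^bsub>R\<^esub> x \<otimes>\<^bsub>R\<^esub> y) = \<zero>\<^bsub>real_ring\<^esub>"
      using xy(2) by (simp add: value_at.R.minus_eq value_at.S.r_neg)
    then have "\<one>\<^bsub>R\<^esub> \<ominus>\<^bsub>R\<^esub> x \<otimes>\<^bsub>R\<^esub> y \<in> K"
      using value_at.R.minus_closed[OF one(1) xy(2)] K by (auto simp: vanishing_def real_ring_simps)
    then have "(\<one>\<^bsub>R\<^esub> \<ominus>\<^bsub>R\<^esub> x \<otimes>\<^bsub>R\<^esub> y) \<oplus>\<^bsub>R\<^esub> x \<otimes>\<^bsub>R\<^esub> y \<in> K"
      using xy(1) by (rule K.a_closed)
    moreover have "(\<one>\<^bsub>R\<^esub> \<ominus>\<^bsub>R\<^esub> x \<otimes>\<^bsub>R\<^esub> y) \<oplus>\<^bsub>R\<^esub> x \<otimes>\<^bsub>R\<^esub> y = \<one>\<^bsub>R\<^esub>"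
      using xy(2) one(1) by (simp add: value_at.R.minus_eq value_at.R.a_assoc value_at.R.l_neg)
    ultimately have "K = carrier R" using K.one_imp_carrier by simp
    then show False using K by simp
  qed
  then show "K = vanishing" using K by blast
qed

lemma stalk_ideal_eq:
  assumes "local_graded_algebra n R"
  shows "stalk_ideal n X m = vanishing"
  unfolding stalk_ideal_def
  using assms vanishing_maximal unfolding local_graded_algebra_def by (rule the1_equality)

section \<open>Approximation of series by polynomials\<close>

definition approximable :: "nat \<Rightarrow> point set \<Rightarrow> series \<Rightarrow> bool" where
  "approximable k B F \<longleftrightarrow> F \<in> carrier (S B) \<and>
     (\<exists>P\<in>polynomial_sections n p q d V.
        chart_germ B F \<ominus>\<^bsub>R\<^esub> chart_germ V P \<in> ideal_power R vanishing k)"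

lemma ideal_power_vanishing: "ideal (ideal_power R vanishing k) R"
  by (rule ideal_power_is_ideal[OF stalk_ring vanishing_ideal])

context
  fixes B assumes B: "openin (Euclidean_space p) B" "B \<subseteq> V" "(\<lambda>i. 0) \<in> B"
begin

lemma approximable_const: "approximable k B (base_series B (\<lambda>x. c))"
proof -
  let ?P = "base_series V (\<lambda>x. c)"
  have P: "?P \<in> polynomial_sections n p q d V" by (rule polynomial_sections_const[OF V])
  then have carr: "?P \<in> carrier (S V)" by (simp add: polynomial_sections_iff)
  have "base_series B (\<lambda>x. c) = (\<lambda>\<mu> x. if x \<in> B then ?P \<mu> x else 0)"
    using B(2) by (auto simp: fun_eq_iff base_series_def)
  then have "chart_germ B (base_series B (\<lambda>x. c)) = chart_germ V ?P"
    using chart_germ_restr[OF B carr] by simp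
  moreover have "chart_germ V ?P \<in> carrier R"
    by (rule chart_germ_closed[OF V order_refl origin_in_V carr])
  ultimately have "chart_germ B (base_series B (\<lambda>x. c)) \<ominus>\<^bsub>R\<^esub> chart_germ V ?P = \<zero>\<^bsub>R\<^esub>"
    by (simp add: value_at.R.minus_eq value_at.R.r_neg)
  moreover have "\<zero>\<^bsub>R\<^esub> \<in> ideal_power R vanishing k"
    using ideal_power_vanishing by (simp add: additive_subgroup.zero_closed ideal.axioms(1))
  ultimately show ?thesis
    unfolding approximable_def using P base_series_in_carrier[OF B(1) smooth_fun_const] by metis
qed

lemma approximable_add:
  assumes "approximable k B F" "approximable k B G"
  shows "approximable k B (\<lambda>\<mu> x. F \<mu> x + G \<mu> x)"
proof -
  obtain P where P: "P \<in> polynomial_sections n p q d V" "F \<in> carrier (S B)"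
    "chart_germ B F \<ominus>\<^bsub>R\<^esub> chart_germ V P \<in> ideal_power R vanishing k"
    using assms(1) unfolding approximable_def by blast
  obtain Q where Q: "Q \<in> polynomial_sections n p q d V" "G \<in> carrier (S B)"
    "chart_germ B G \<ominus>\<^bsub>R\<^esub> chart_germ V Q \<in> ideal_power R vanishing k"
    using assms(2) unfolding approximable_def by blast
  let ?a = "chart_germ B F" and ?b = "chart_germ V P" and ?c = "chart_germ B G" and ?e = "chart_germ V Q"
  have PQ: "P \<in> carrier (S V)" "Q \<in> carrier (S V)" using P Q by (simp_all add: polynomial_sections_iff)
  have carr: "?a \<in> carrier R" "?b \<in> carrier R" "?c \<in> carrier R" "?e \<in> carrier R"
    using P(2) Q(2) PQ chart_germ_closed[OF B] chart_germ_closed[OF V order_refl origin_in_V] by auto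
  have "(?a \<oplus>\<^bsub>R\<^esub> ?c) \<ominus>\<^bsub>R\<^esub> (?b \<oplus>\<^bsub>R\<^esub> ?e) = (?a \<ominus>\<^bsub>R\<^esub> ?b) \<oplus>\<^bsub>R\<^esub> (?c \<ominus>\<^bsub>R\<^esub> ?e)"
    using carr by (simp add: value_at.R.minus_eq value_at.R.minus_add value_at.R.a_ac)
  also have "\<dots> \<in> ideal_power R vanishing k"
    using P(3) Q(3) ideal_power_vanishing
    by (simp add: additive_subgroup.a_closed ideal.axioms(1))
  finally have "chart_germ B (\<lambda>\<mu> x. F \<mu> x + G \<mu> x) \<ominus>\<^bsub>R\<^esub> chart_germ V (\<lambda>\<mu> x. P \<mu> x + Q \<mu> x)
      \<in> ideal_power R vanishing k"
    using chart_germ_add[OF B P(2) Q(2)] chart_germ_add[OF V order_refl origin_in_V PQ] by simp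
  then show ?thesis
    unfolding approximable_def
    using carrier_series_add[OF P(2) Q(2)] polynomial_sections_add[OF P(1) Q(1)] by blast
qed

lemma approximable_sum:
  assumes "finite A" "\<And>i. i \<in> A \<Longrightarrow> approximable k B (F i)"
  shows "approximable k B (\<lambda>\<mu> x. \<Sum>i\<in>A. F i \<mu> x)"
  using assms
proof (induction A)
  case empty
  have "base_series B (\<lambda>x. 0) = (\<lambda>\<mu> x. 0)" by (simp add: fun_eq_iff base_series_def)
  then show ?case using approximable_const[of k 0] by simp
next
  case (insert i A)
  then show ?case using approximable_add[of k "F i" "\<lambda>\<mu> x. \<Sum>i\<in>A. F i \<mu> x"] by simp
qed

text \<open>The step that raises the order: \<open>(F - P) z = F z - P z\<close>, where
  \<open>z\<close> lies in \<open>vanishing\<close> because its trivial coefficient is 0 at the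
  origin. The element is needed twice, as \<open>z\<close> over \<open>V\<close> to multiply
  \<open>P\<close> and as its restriction \<open>z'\<close> to multiply \<open>F\<close>; their
  germs coincide.\<close>

lemma approximable_mult:
  assumes F: "approximable k B F"
    and z: "z \<in> carrier (S V)" "z (\<lambda>a. 0) (\<lambda>i. 0) = 0"
    and z': "z' \<in> carrier (S B)" "z' = (\<lambda>\<mu> x. if x \<in> B then z \<mu> x else 0)"
    and closed: "series_mult n q d F z' \<in> carrier (S B)"
    and poly: "\<And>P. P \<in> polynomial_sections n p q d V \<Longrightarrow>
      series_mult n q d P z \<in> polynomial_sections n p q d V"
  shows "approximable (Suc k) B (series_mult n q d F z')"
proof -
  obtain P where P: "P \<in> polynomial_sections n p q d V" "F \<in> carrier (S B)"
    "chart_germ B F \<ominus>\<^bsub>R\<^esub> chart_germ V P \<in> ideal_power R vanishing k"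
    using F unfolding approximable_def by blast
  have PV: "P \<in> carrier (S V)" using P by (simp add: polynomial_sections_iff)
  let ?a = "chart_germ B F" and ?b = "chart_germ V P" and ?z = "chart_germ V z"
  have carr: "?a \<in> carrier R" "?b \<in> carrier R" "?z \<in> carrier R"
    using P(2) PV z(1) chart_germ_closed[OF B] chart_germ_closed[OF V order_refl origin_in_V] by auto
  have eq: "chart_germ B z' = ?z" unfolding z'(2) by (rule chart_germ_restr[OF B z(1)])
  have "?z \<in> vanishing"
    using carr(3) z value_at_chart_germ[OF V order_refl origin_in_V z(1)] by (simp add: vanishing_def)
  with P(3) have "(?a \<ominus>\<^bsub>R\<^esub> ?b) \<otimes>\<^bsub>R\<^esub> ?z \<in> ideal_power R vanishing (Suc k)"
    unfolding ideal_power_Suc by (rule ideal_prod.prod)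
  moreover have "(?a \<ominus>\<^bsub>R\<^esub> ?b) \<otimes>\<^bsub>R\<^esub> ?z = ?a \<otimes>\<^bsub>R\<^esub> ?z \<ominus>\<^bsub>R\<^esub> ?b \<otimes>\<^bsub>R\<^esub> ?z"
    using carr by (simp add: value_at.R.minus_eq value_at.R.l_distr value_at.R.l_minus)
  ultimately have "chart_germ B (series_mult n q d F z') \<ominus>\<^bsub>R\<^esub> chart_germ V (series_mult n q d P z)
      \<in> ideal_power R vanishing (Suc k)"
    using chart_germ_mult[OF B P(2) z'(1)] chart_germ_mult[OF V order_refl origin_in_V PV z(1)] eq by simp
  then show ?thesis unfolding approximable_def using closed poly[OF P(1)] by blast
qed

lemma approximable_mult_coordinate:
  assumes F: "approximable k B F" and i: "i < p"
  shows "approximable (Suc k) B (series_mult n q d F (base_series B (\<lambda>x. x i)))"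
proof (rule approximable_mult[OF F])
  have "F \<in> carrier (S B)" using F by (simp add: approximable_def)
  then show "series_mult n q d F (base_series B (\<lambda>x. x i)) \<in> carrier (S B)"
    by (rule carrier_series_mult_coordinate)
  show "base_series B (\<lambda>x. x i) = (\<lambda>\<mu> x. if x \<in> B then base_series V (\<lambda>x. x i) \<mu> x else 0)"
    using B(2) by (auto simp: fun_eq_iff base_series_def)
  show "base_series V (\<lambda>x. x i) (\<lambda>a. 0) (\<lambda>i. 0) = 0" by (simp add: base_series_def)
qed (use i in \<open>auto intro: base_series_in_carrier V B(1) smooth_fun_coord polynomial_sections_mult_coordinate\<close>)

lemma approximable_mult_formal_variable:
  assumes F: "approximable k B F" and a: "a < q"
  shows "approximable (Suc k) B (series_mult n q d F (formal_variable B a))"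
proof (rule approximable_mult[OF F])
  have "F \<in> carrier (S B)" using F by (simp add: approximable_def)
  then show "series_mult n q d F (formal_variable B a) \<in> carrier (S B)"
    using a by (rule carrier_series_mult_formal_variable)
  show "formal_variable B a = (\<lambda>\<mu> x. if x \<in> B then formal_variable V a \<mu> x else 0)"
    using B(2) by (auto simp: fun_eq_iff formal_variable_def)
  show "formal_variable V a (\<lambda>a. 0) (\<lambda>i. 0) = 0" by (auto simp: formal_variable_def fun_eq_iff)
qed (use a in \<open>auto intro: formal_variable_in_carrier V B(1) polynomial_sections_mult_formal_variable\<close>)

end

text \<open>The series \<open>F\<close> is generalised because the induction hypothesis is applied
  to the quotients \<open>D i\<close> and \<open>G a\<close>, which are series over the same cube.
  For \<open>k = 0\<close> the power is the whole ring and the zero polynomial serves.\<close>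

lemma approximable_on_cube:
  assumes r: "r > 0" "cube p r \<subseteq> V" and F: "F \<in> carrier (S (cube p r))"
  shows "approximable k (cube p r) F"
  using F
proof (induction k arbitrary: F)
  have B: "openin (Euclidean_space p) (cube p r)" "cube p r \<subseteq> V" "(\<lambda>i. 0) \<in> cube p r"
    using r openin_cube by (auto simp: cube_def)
  {
    case 0
    have P: "base_series V (\<lambda>x. 0) \<in> polynomial_sections n p q d V" by (rule polynomial_sections_const[OF V])
    then have "chart_germ V (base_series V (\<lambda>x. 0)) \<in> carrier R"
      using chart_germ_closed[OF V order_refl origin_in_V] by (simp add: polynomial_sections_iff)
    then show ?case
      unfolding approximable_def ideal_power_0 using 0 P chart_germ_closed[OF B 0] by blast
  next
    case (Suc k)
    obtain c D G where
      D: "\<And>i. i < p \<Longrightarrow> D i \<in> carrier (S (cube p r))" and G: "\<And>a. G a \<in> carrier (S (cube p r))" and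
      eq: "F = (\<lambda>\<mu> x. base_series (cube p r) (\<lambda>x. c) \<mu> x +
            ((\<Sum>i<p. series_mult n q d (D i) (base_series (cube p r) (\<lambda>x. x i)) \<mu> x) +
             (\<Sum>a<q. series_mult n q d (G a) (formal_variable (cube p r) a) \<mu> x)))"
      using hadamard_series[OF Suc.prems r(1)] by blast
    show ?case
      unfolding eq
      using Suc.IH[OF D] Suc.IH[OF G]
      by (intro approximable_add[OF B] approximable_sum[OF B] approximable_const[OF B]
          approximable_mult_coordinate[OF B] approximable_mult_formal_variable[OF B]) auto
  }
qed

lemma polynomial_approximation:
  assumes U: "nbhd U" and f: "f \<in> carrier (sections X U)"
  shows "\<exists>P\<in>polynomial_sections n p q d V.
    germ X m U f \<ominus>\<^bsub>R\<^esub> germ X m W (h V P) \<in> ideal_power R vanishing k"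
proof -
  have UW: "openin (base X) (U \<inter> W)" "U \<inter> W \<subseteq> W" "m \<in> U \<inter> W" using U W by auto
  \<comment> \<open>The function lives on \<open>U\<close> and the chart on \<open>W\<close>; a cube
    inside the image of \<open>U \<inter> W\<close> pulls back into both.\<close>
  obtain r where r: "r > 0" "cube p r \<subseteq> push (U \<inter> W)"
    using cube_neighbourhood[OF open_push(1)[OF UW(1,2)] origin_in_push[OF UW(3)]] .
  let ?B = "cube p r"
  let ?N = "pull ?B"
  have B: "openin (Euclidean_space p) ?B" "?B \<subseteq> V" "(\<lambda>i. 0) \<in> ?B"
    using r openin_cube by (auto simp: cube_def push_def)
  have N: "nbhd ?N" "?N \<subseteq> W" using nbhd_pull[OF B] open_pull[OF B(1,2)] by auto
  have "?N \<subseteq> pull (push (U \<inter> W))" using r(2) by (auto simp: pull_def)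
  then have NU: "?N \<subseteq> U" using pull_push[of "U \<inter> W"] by auto
  \<comment> \<open>The coordinate expression of \<open>f\<close> over the cube. Since
    \<open>h\<close> undoes \<open>g\<close>, its germ is that of \<open>f\<close>.\<close>
  define F where "F = g ?N (restr X U ?N f)"
  have fN: "restr X U ?N f \<in> carrier (sections X ?N)" using restr_closed U N NU f by blast
  then have F: "F \<in> carrier (S ?B)"
    using ring_hom_closed[OF g_ring_hom[of ?N]] N by (simp add: F_def push_pull[OF B(2)])
  have "chart_germ ?B F = germ X m ?N (restr X U ?N f)"
    using h_g[of ?N "restr X U ?N f"] fN N by (simp add: chart_germ_def F_def chart_simps push_pull[OF B(2)])
  also have "\<dots> = germ X m U f" by (rule germ_restr[OF U N(1) NU f])
  finally have "chart_germ ?B F = germ X m U f" .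
  moreover have "chart_germ V P = germ X m W (h V P)" for P by (simp add: chart_germ_def pull_V)
  ultimately show ?thesis
    using approximable_on_cube[OF r(1) B(2) F] unfolding approximable_def by simp
qed

end

theorem theorem6p10:
  fixes n p q k :: nat and Q :: "nat \<Rightarrow> nat" and d :: "nat \<Rightarrow> degree"
    and X :: "('m, 'a) graded_space" and m :: 'm and U W :: "'m set" and f :: 'a
    and V :: "point set" and \<phi> :: "'m \<Rightarrow> point" and h :: "point set \<Rightarrow> series \<Rightarrow> 'a"
  assumes "Z2n_supermanifold n p Q X"
    and "m \<in> topspace (base X)"
    and "openin (base X) U" and "m \<in> U" and "f \<in> carrier (sections X U)"
    and "centered_coordinates n p Q X m W q d V \<phi> h"
    and "k \<noteq> 0"
  shows "\<exists>P \<in> polynomial_sections n p q d V.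
           germ X m U f \<ominus>\<^bsub>stalk X m\<^esub> germ X m W (h V P) \<in> ideal_power (stalk X m) (stalk_ideal n X m) k"
proof -
  have ringed: "locally_Z2n_ringed_space n X"
    using assms(1) by (simp add: Z2n_supermanifold_def)
  have W: "openin (base X) W" "m \<in> W" and V: "openin (Euclidean_space p) V" and c: "\<phi> m = (\<lambda>i. 0)"
    and iso: "space_isomorphism n (open_subspace X W) (superdomain n p q d V) \<phi> h"
    using assms(6) by (simp_all add: centered_coordinates_def superdomain_of_dim_def)
  have tops: "topspace (base (superdomain n p q d V)) = V" "topspace (base (open_subspace X W)) = W"
    using openin_subset[OF V] openin_subset[OF W(1)] by (auto simp: superdomain_def open_subspace_def)
  obtain \<psi> g where "centered_chart n X m p q d W V \<phi> h \<psi> g"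
  proof -
    from iso obtain \<psi> g where "space_morphism n (open_subspace X W) (superdomain n p q d V) \<phi> h"
      "space_morphism n (superdomain n p q d V) (open_subspace X W) \<psi> g"
      "\<forall>x\<in>W. \<psi> (\<phi> x) = x" "\<forall>y\<in>V. \<phi> (\<psi> y) = y"
      "\<forall>B. openin (base (superdomain n p q d V)) B \<longrightarrow>
         (\<forall>F\<in>carrier (sections (superdomain n p q d V) B). g (preim (open_subspace X W) \<phi> B) (h B F) = F)"
      "\<forall>N. openin (base (open_subspace X W)) N \<longrightarrow>
         (\<forall>s\<in>carrier (sections (open_subspace X W) N). h (preim (superdomain n p q d V) \<psi> N) (g N s) = s)"
      unfolding space_isomorphism_def tops by (elim conjE exE) (rule that)
    then have "centered_chart n X m p q d W V \<phi> h \<psi> g"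
      using ringed assms(2) W V c
      by unfold_locales (auto simp: locally_Z2n_ringed_space_def algebra_sheaf_def)
    then show ?thesis by (rule that)
  qed
  then interpret centered_chart n X m p q d W V \<phi> h \<psi> g .
  \<comment> \<open>Uniqueness of the maximal homogeneous ideal gives the description in
    \<open>stalk_ideal\<close> a value, which \<open>stalk_ideal_eq\<close> identifies with
    \<open>vanishing\<close>.\<close>
  have "local_graded_algebra n (stalk X m)"
    using ringed assms(2) by (simp add: locally_Z2n_ringed_space_def)
  then show ?thesis
    using polynomial_approximation[of U f k] assms(3-5) by (simp add: stalk_ideal_eq)
qed

end
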